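(* Let $k>1$ be an integer, $D>0$ a non-square discriminant, and $\mathcal{A}\subseteq\mathcal{Q}_D$ a narrow equivalence class. Then $\mathcal{F}_{1-k,D,\mathcal{A}}$ is a weight $2-2k$ locally harmonic Maass form for $\Gamma_1=\mathrm{SL}_2(\mathbb{Z})$ with exceptional set $E_D$.
   Context: Write $\tau=x+iy\in\mathbb{H}$. A discriminant is an integer $\equiv0,1\pmod4$. $\mathcal{Q}_D$ is the set of $Q=[a,b,c]$, $Q(X,Y)=aX^2+bXY+cY^2$, $a,b,c\in\mathbb{Z}$, $b^2-4ac=D$. A narrow equivalence class is a $\Gamma_1$-orbit for the action $(Q\circ\gamma)(X,Y)=Q(\alpha X+\beta Y,\gamma'X+\delta Y)$. Let $\psi(v):=\frac12\int_0^vu^{k-\frac32}(1-u)^{-\frac12}du$ and $$\mathcal{F}_{1-k,D,\mathcal{A}}(\tau):=\frac{(-1)^kD^{\frac12-k}}{\binom{2k-2}{k-1}\pi}\sum_{Q=[a,b,c]\in\mathcal{A}}\operatorname{sgn}\left(a|\tau|^2+bx+c\right)Q(\tau,1)^{k-1}\psi\left(\frac{Dy^2}{|Q(\tau,1)|^2}\right)$$ ($\operatorname{sgn}(0)=0$). $E_D:=\{\tau\in\mathbb{H}:\exists[a,b,c]\in\mathcal{Q}_D,\ a|\tau|^2+bx+c=0\}$. For $\gamma=\begin{pmatrix}a&b\\c&d\end{pmatrix}\in\Gamma_1$, $(F|_{2-2k}\gamma)(\tau):=(c\tau+d)^{2k-2}F(\gamma\tau)$; $\Delta_{2-2k}:=-y^2\left(\frac{\partial^2}{\partial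 x^2}+\frac{\partial^2}{\partial y^2}\right)+i(2-2k)y\left(\frac{\partial}{\partial x}+i\frac{\partial}{\partial y}\right)$. A weight $2-2k$ locally harmonic Maass form with exceptional set $E_D$ is $F:\mathbb{H}\to\mathbb{C}$ with: (1) $F|_{2-2k}\gamma=F$ for all $\gamma\in\Gamma_1$; (2) each $\tau\in\mathbb{H}\setminus E_D$ has a neighborhood on which $F$ is real analytic and $\Delta_{2-2k}F=0$; (3) for $\tau\in E_D$, $F(\tau)=\frac12\lim_{w\to0^+}(F(\tau+iw)+F(\tau-iw))$; (4) $F$ has at most polynomial growth towards $i\infty$. *)

theory Defs
  imports "HOL-Analysis.Analysis"
begin

definition upper_half_plane :: "complex set" where
  "upper_half_plane = {\<tau>. Im \<tau> > 0}"


subsection \<open>Integral binary quadratic forms\<close>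

text \<open>The triple \<open>(a, b, c)\<close> stands for the form \<open>[a, b, c] = a X^2 + b X Y + c Y^2\<close>.\<close>

type_synonym form = "int \<times> int \<times> int"

fun form_eval :: "form \<Rightarrow> 'a::comm_ring_1 \<Rightarrow> 'a \<Rightarrow> 'a" where
  "form_eval (a, b, c) X Y = of_int a * X^2 + of_int b * X * Y + of_int c * Y^2"

definition is_discriminant :: "int \<Rightarrow> bool" where
  "is_discriminant D \<longleftrightarrow> D mod 4 = 0 \<or> D mod 4 = 1"

definition forms_of_disc :: "int \<Rightarrow> form set" where
  "forms_of_disc D = {(a, b, c). b^2 - 4 * a * c = D}"

text \<open>A quadruple \<open>(\<alpha>, \<beta>, \<gamma>, \<delta>)\<close> is the matrix with rows \<open>(\<alpha>, \<beta>)\<close> and \<open>(\<gamma>, \<delta>)\<close>.\<close>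

definition SL2Z :: "(int \<times> int \<times> int \<times> int) set" where
  "SL2Z = {(\<alpha>, \<beta>, \<gamma>, \<delta>). \<alpha> * \<delta> - \<beta> * \<gamma> = 1}"

text \<open>The coefficients of \<open>Q(\<alpha> X + \<beta> Y, \<gamma> X + \<delta> Y)\<close>; see \<open>form_eval_form_act\<close>.\<close>

fun form_act :: "form \<Rightarrow> int \<times> int \<times> int \<times> int \<Rightarrow> form" where
  "form_act (a, b, c) (\<alpha>, \<beta>, \<gamma>, \<delta>) =
     (a * \<alpha>^2 + b * \<alpha> * \<gamma> + c * \<gamma>^2,
      2 * a * \<alpha> * \<beta> + b * (\<alpha> * \<delta> + \<beta> * \<gamma>) + 2 * c * \<gamma> * \<delta>,
      a * \<beta>^2 + b * \<beta> * \<delta> + c * \<delta>^2)"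

lemma form_eval_form_act:
  fixes X Y :: "'a::comm_ring_1"
  shows "form_eval (form_act Q (\<alpha>, \<beta>, \<gamma>, \<delta>)) X Y =
         form_eval Q (of_int \<alpha> * X + of_int \<beta> * Y) (of_int \<gamma> * X + of_int \<delta> * Y)"
  by (cases Q) (simp add: power2_eq_square algebra_simps)

definition narrow_class :: "int \<Rightarrow> form set \<Rightarrow> bool" where
  "narrow_class D A \<longleftrightarrow> (\<exists>Q\<in>forms_of_disc D. A = form_act Q ` SL2Z)"

text \<open>The real number \<open>a \<bar>\<tau>\<bar>^2 + b x + c\<close>; it vanishes exactly on the geodesic attached to the form.\<close>

fun form_height :: "form \<Rightarrow> complex \<Rightarrow> real" where
  "form_height (a, b, c) \<tau> = of_int a * (cmod \<tau>)^2 + of_int b * Re \<tau> + of_int c"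

definition exceptional_set :: "int \<Rightarrow> complex set" where
  "exceptional_set D =
     {\<tau>\<in>upper_half_plane. \<exists>Q\<in>forms_of_disc D. form_height Q \<tau> = 0}"


subsection \<open>The function attached to a narrow class\<close>

text \<open>At \<open>u = 1\<close> the integrand takes the value \<open>0 powr (-1/2) = 0\<close>, which does not affect
  the (absolutely convergent) integral.\<close>

definition psi :: "nat \<Rightarrow> real \<Rightarrow> real" where
  "psi k v = 1/2 * integral {0..v} (\<lambda>u. u powr (real k - 3/2) * (1 - u) powr (-1/2))"

definition F_summand :: "nat \<Rightarrow> int \<Rightarrow> complex \<Rightarrow> form \<Rightarrow> complex" where
  "F_summand k D \<tau> Q =
     of_real (sgn (form_height Q \<tau>)) * form_eval Q \<tau> 1 ^ (k - 1) *
     of_real (psi k (real_of_int D * (Im \<tau>)^2 / (cmod (form_eval Q \<tau> 1))^2))"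

definition F_class :: "nat \<Rightarrow> int \<Rightarrow> form set \<Rightarrow> complex \<Rightarrow> complex" where
  "F_class k D A \<tau> =
     of_real ((-1)^k * real_of_int D powr (1/2 - real k) /
              (real ((2 * k - 2) choose (k - 1)) * pi)) *
     (\<Sum>\<^sub>\<infinity>Q\<in>A. F_summand k D \<tau> Q)"


subsection \<open>Locally harmonic Maass forms\<close>

text \<open>Functions on the upper half plane are modelled as functions on all of \<open>\<complex>\<close> whose values outside
  the upper half plane are never used.\<close>

fun moebius_act :: "int \<times> int \<times> int \<times> int \<Rightarrow> complex \<Rightarrow> complex" where
  "moebius_act (a, b, c, d) \<tau> = (of_int a * \<tau> + of_int b) / (of_int c * \<tau> + of_int d)"

fun slash :: "int \<Rightarrow> (complex \<Rightarrow> complex) \<Rightarrow> int \<times> int \<times> int \<times> int \<Rightarrow> complex \<Rightarrow> complex" where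
  "slash \<kappa> F (a, b, c, d) \<tau> =
     (of_int c * \<tau> + of_int d) powi (- \<kappa>) * F (moebius_act (a, b, c, d) \<tau>)"

text \<open>Real analyticity in the two real variables \<open>x, y\<close>: near each point the function is the sum of
  an (absolutely) convergent double power series.\<close>

definition real_analytic_on :: "(complex \<Rightarrow> complex) \<Rightarrow> complex set \<Rightarrow> bool" where
  "real_analytic_on F U \<longleftrightarrow>
     (\<forall>\<tau>\<in>U. \<exists>r>0. \<exists>coef :: nat \<Rightarrow> nat \<Rightarrow> complex. \<forall>s t :: real.
        \<bar>s\<bar> < r \<and> \<bar>t\<bar> < r \<longrightarrow>
        ((\<lambda>(m, n). coef m n * of_real s ^ m * of_real t ^ n) has_sum F (\<tau> + Complex s t)) UNIV)"

definition partial_x :: "(complex \<Rightarrow> complex) \<Rightarrow> complex \<Rightarrow> complex" where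
  "partial_x F \<tau> = vector_derivative (\<lambda>s. F (\<tau> + of_real s)) (at 0)"

definition partial_y :: "(complex \<Rightarrow> complex) \<Rightarrow> complex \<Rightarrow> complex" where
  "partial_y F \<tau> = vector_derivative (\<lambda>t. F (\<tau> + \<i> * of_real t)) (at 0)"

definition hyperbolic_laplacian :: "int \<Rightarrow> (complex \<Rightarrow> complex) \<Rightarrow> complex \<Rightarrow> complex" where
  "hyperbolic_laplacian \<kappa> F \<tau> =
     - of_real ((Im \<tau>)^2) * (partial_x (partial_x F) \<tau> + partial_y (partial_y F) \<tau>)
     + \<i> * of_int \<kappa> * of_real (Im \<tau>) * (partial_x F \<tau> + \<i> * partial_y F \<tau>)"

text \<open>Growth towards \<open>i \<infinity>\<close> is measured by \<open>y = Im \<tau> \<rightarrow> \<infinity>\<close>, uniformly in \<open>x = Re \<tau>\<close>.\<close>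

definition polynomial_growth_at_ii_inf :: "(complex \<Rightarrow> complex) \<Rightarrow> bool" where
  "polynomial_growth_at_ii_inf F \<longleftrightarrow>
     (\<exists>(N::nat) (C::real) (Y::real). Y > 0 \<and>
        (\<forall>\<tau>. Im \<tau> \<ge> Y \<longrightarrow> cmod (F \<tau>) \<le> C * (Im \<tau>) ^ N))"

definition locally_harmonic_Maass_form ::
    "int \<Rightarrow> complex set \<Rightarrow> (complex \<Rightarrow> complex) \<Rightarrow> bool" where
  "locally_harmonic_Maass_form \<kappa> E F \<longleftrightarrow>
     (\<forall>\<gamma>\<in>SL2Z. \<forall>\<tau>\<in>upper_half_plane. slash \<kappa> F \<gamma> \<tau> = F \<tau>) \<and>
     (\<forall>\<tau>\<in>upper_half_plane - E. \<exists>U. open U \<and> \<tau> \<in> U \<and> U \<subseteq> upper_half_plane \<and>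
        real_analytic_on F U \<and> (\<forall>z\<in>U. hyperbolic_laplacian \<kappa> F z = 0)) \<and>
     (\<forall>\<tau>\<in>E. ((\<lambda>w::real. 1/2 * (F (\<tau> + \<i> * of_real w) + F (\<tau> - \<i> * of_real w)))
                 \<longlongrightarrow> F \<tau>) (at_right 0)) \<and>
     polynomial_growth_at_ii_inf F"

end

theory Submission
  imports Defs "HOL-Complex_Analysis.Complex_Analysis"
begin

text \<open>
  Write \<open>h\<close> for the height \<open>a \<bar>\<tau>\<bar>\<^sup>2 + b x + c\<close> of \<open>Q = [a, b, c]\<close>, and \<open>Q\<close> also for \<open>Q(\<tau>, 1)\<close>. The identity
  \<open>\<bar>Q\<bar>\<^sup>2 = h\<^sup>2 + D y\<^sup>2\<close> shows that the argument of \<open>\<psi>\<close> lies in \<open>[0, 1]\<close>, and the summand attached to \<open>Q\<close>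
  is \<open>O(y\<^bsup>2k-1\<^esup> \<bar>Q\<bar>\<^bsup>-k\<^esup>)\<close>. On a strip \<open>\<bar>x\<bar> \<le> R\<close>, \<open>y \<ge> \<delta>\<close> one has \<open>\<bar>Q\<bar>\<^sup>2 \<ge> const (1 + b\<^sup>2)\<close>, and since \<open>D\<close> is not a
  square the number of forms with given \<open>b\<close> is at most twice the number of divisors of \<open>b\<^sup>2 - D \<noteq> 0\<close>, which is
  \<open>O(\<bar>b\<bar>\<^bsup>2/3\<^esup>)\<close>; so the series converges normally on such strips. Modularity is a reindexing of the sum, and
  the growth bound follows from the majorant after a translation.

  Off the geodesic \<open>h = 0\<close> the summand satisfies
  \<open>\<partial>/\<partial>cnj \<tau> = (\<i>/2) D\<^bsup>k-1/2\<^esup> y\<^bsup>2k-2\<^esup> cnj (Q\<^bsup>-k\<^esup>)\<close>. Subtracting the non-holomorphic Eichler integral of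
  \<open>q = \<Sum> Q\<^bsup>-k\<^esup>\<close>, which has the same \<open>cnj\<close>-derivative, leaves a uniform limit of holomorphic functions on
  any disc that meets no geodesic. Hence the function is locally a finite sum of products of holomorphic and
  antiholomorphic functions, from which real analyticity and the Laplace equation can be read off. On a
  geodesic the summands that jump cancel in the mean because \<open>h\<close> changes sign there.
\<close>

subsection \<open>The divisor bound and the sum over forms\<close>

lemma card_divisors_mult_le:
  fixes m n :: nat
  assumes "m > 0" "n > 0"
  shows "card {d. d dvd m * n} \<le> card {d. d dvd m} * card {d. d dvd n}"
proof -
  have fin: "finite {d. d dvd m}" "finite {d. d dvd n}"
    using assms finite_divisors_nat by auto
  have "{d. d dvd m * n} \<subseteq> (\<lambda>(x, y). x * y) ` ({d. d dvd m} \<times> {d. d dvd n})"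
  proof
    fix d assume "d \<in> {d. d dvd m * n}"
    then obtain x y where "d = x * y" "x dvd m" "y dvd n"
      using division_decomp by blast
    then show "d \<in> (\<lambda>(x, y). x * y) ` ({d. d dvd m} \<times> {d. d dvd n})" by auto
  qed
  then have "card {d. d dvd m * n} \<le> card ({d. d dvd m} \<times> {d. d dvd n})"
    using fin by (intro surj_card_le) auto
  then show ?thesis by (simp add: card_cartesian_product)
qed

lemma card_divisors_prime_power_le:
  fixes p :: nat
  assumes "prime p"
  shows "card {d. d dvd p ^ e} \<le> e + 1"
proof -
  have "{d. d dvd p ^ e} \<subseteq> (\<lambda>i. p ^ i) ` {..e}"
    using divides_primepow_nat[OF assms] by auto
  then have "card {d. d dvd p ^ e} \<le> card {..e}"
    by (intro surj_card_le) auto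
  then show ?thesis by simp
qed

text \<open>The ratio \<open>(e + 1)^3 / 2^e\<close> peaks at \<open>e = 3\<close>, where it equals
  8. From there on \<open>3 (e+1)^2 + 3 (e+1) + 1 <= (e+1)^3\<close>, so one step at most doubles
  the cube. This is the price 8 of a small prime in the divisor bound.\<close>

lemma Suc_cube_le: "(e + 1) ^ 3 \<le> 8 * (2::nat) ^ e"
proof (cases "e \<le> 3")
  case True
  then have "e = 0 \<or> e = 1 \<or> e = 2 \<or> e = 3" by auto
  then show ?thesis by (auto simp: power3_eq_cube)
next
  case False
  then have "e \<ge> 3" by simp
  then show ?thesis
  proof (induction e rule: dec_induct)
    case (step e)
    have "3 * (e+1)^2 + 3 * (e+1) + 1 \<le> 4 * (e+1)^2"
    proof -
      have "4 * (e+1) \<le> (e+1) * (e+1)" using step by (intro mult_right_mono) auto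
      then show ?thesis using step by (simp add: power2_eq_square)
    qed
    also have "\<dots> \<le> (e+1) * (e+1)^2" using step by (intro mult_right_mono) auto
    also have "\<dots> = (e+1)^3" by (simp only: power3_eq_cube power2_eq_square mult.assoc)
    finally have "(Suc e + 1)^3 \<le> 2 * (e+1)^3"
      by (simp add: power3_eq_cube power2_eq_square algebra_simps)
    then show ?case using step.IH by simp
  qed auto
qed

text \<open>Stripping off one prime factor \<open>p\<close> at most doubles the divisor count, so
  its cube changes by at most the factor 8, which \<open>p >= 8\<close> pays for.\<close>

lemma card_divisors_cube_le_large_primes:
  fixes n :: nat
  assumes "n > 0" "\<And>q. prime q \<Longrightarrow> q dvd n \<Longrightarrow> q \<ge> 8"
  shows "card {d. d dvd n} ^ 3 \<le> n"
  using assms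
proof (induction n rule: less_induct)
  case (less n)
  show ?case
  proof (cases "n = 1")
    case False
    then obtain p where p: "prime p" "p dvd n" using prime_factor_nat by blast
    then obtain m where m: "n = p * m" by auto
    have m0: "m > 0" and p0: "p > 0" using less.prems m by auto
    have "m < n" using m p m0 prime_gt_1_nat[OF p(1)] by simp
    then have IH: "card {d. d dvd m} ^ 3 \<le> m" using less m m0 by auto
    have "card {d. d dvd n} \<le> card {d. d dvd p} * card {d. d dvd m}"
      using card_divisors_mult_le[OF p0 m0] m by simp
    also have "\<dots> \<le> 2 * card {d. d dvd m}"
      using card_divisors_prime_power_le[OF p(1), of 1] by (intro mult_le_mono) auto
    finally have "card {d. d dvd n} \<le> 2 * card {d. d dvd m}" .
    then have "card {d. d dvd n} ^ 3 \<le> (2 * card {d. d dvd m}) ^ 3" by (rule power_mono) simp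
    also have "\<dots> = 8 * card {d. d dvd m} ^ 3" by (simp add: power_mult_distrib)
    also have "\<dots> \<le> p * m" using IH less.prems(2)[OF p] by (intro mult_le_mono) auto
    finally show ?thesis using m by simp
  qed simp
qed

text \<open>Primes at least 8 contribute no constant because \<open>d(p m) \<le> 2 d(m)\<close>; each smaller prime costs a factor 8.\<close>

lemma card_divisors_cube_le:
  obtains C :: nat where "\<And>n::nat. n > 0 \<Longrightarrow> card {d. d dvd n} ^ 3 \<le> C * n"
proof -
  \<comment> \<open>The induction readmits small primes one value at a time: stage \<open>i\<close>
    allows prime factors from \<open>8 - i\<close> on, stage \<open>Suc i\<close> adds at most the
    prime \<open>N\<close>, and at \<open>i = 8\<close> the restriction is void.\<close>
  have "\<forall>n::nat. n > 0 \<longrightarrow> (\<forall>q. prime q \<longrightarrow> q dvd n \<longrightarrow> q \<ge> 8 - i) \<longrightarrow> card {d. d dvd n} ^ 3 \<le> 8 ^ i * n"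
    if "i \<le> 8" for i :: nat
    using that
  proof (induction i)
    case 0
    then show ?case using card_divisors_cube_le_large_primes by auto
  next
    case (Suc i)
    define N where "N = 8 - Suc i"
    have N: "8 - i = Suc N" using Suc.prems N_def by simp
    show ?case
    proof (intro allI impI)
      fix n :: nat
      assume n: "n > 0" and q: "\<forall>q. prime q \<longrightarrow> q dvd n \<longrightarrow> q \<ge> 8 - Suc i"
      show "card {d. d dvd n} ^ 3 \<le> 8 ^ Suc i * n"
      proof (cases "prime N")
        case False
        then have "\<forall>q. prime q \<longrightarrow> q dvd n \<longrightarrow> q \<ge> 8 - i" using q N N_def
          by (metis Suc_leI le_neq_implies_less)
        then have "card {d. d dvd n} ^ 3 \<le> 8 ^ i * n" using Suc n by auto
        then show ?thesis using n by simp
      next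
        case True
        define e where "e = multiplicity N n"
        obtain m where m: "n = N ^ e * m" "\<not> N dvd m"
          using n True by (metis e_def multiplicity_decompose' neq0_conv not_prime_unit)
        have m0: "m > 0" and N0: "N > 0" using m n True prime_gt_0_nat by (auto intro!: Nat.gr0I)
        have "\<forall>q. prime q \<longrightarrow> q dvd m \<longrightarrow> q \<ge> 8 - i" using q N N_def m
          by (metis Suc_leI dvd_mult le_neq_implies_less)
        then have IH: "card {d. d dvd m} ^ 3 \<le> 8 ^ i * m" using Suc m0 by auto
        have "card {d. d dvd n} \<le> card {d. d dvd N ^ e} * card {d. d dvd m}"
          using card_divisors_mult_le[of "N ^ e" m] m0 N0 m(1) by simp
        also have "\<dots> \<le> (e + 1) * card {d. d dvd m}"
          using card_divisors_prime_power_le[OF True, of e] by (intro mult_le_mono) auto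
        finally have "card {d. d dvd n} \<le> (e + 1) * card {d. d dvd m}" .
        then have "card {d. d dvd n} ^ 3 \<le> ((e + 1) * card {d. d dvd m}) ^ 3" by (rule power_mono) simp
        also have "\<dots> = (e + 1) ^ 3 * card {d. d dvd m} ^ 3" by (simp only: power_mult_distrib)
        also have "\<dots> \<le> (8 * N ^ e) * (8 ^ i * m)"
        proof (intro mult_le_mono IH)
          have "(2::nat) ^ e \<le> N ^ e" using prime_ge_2_nat[OF True] by (rule power_mono) simp
          then show "(e + 1) ^ 3 \<le> 8 * N ^ e" using Suc_cube_le[of e] by linarith
        qed
        also have "\<dots> = 8 ^ Suc i * n" using m(1) by simp
        finally show ?thesis .
      qed
    qed
  qed
  from this[of 8] show thesis by (intro that[of "8 ^ 8"]) auto
qed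

section \<open>Summability over all forms of a fixed non-square discriminant\<close>

lemma summable_on_int_powr:
  assumes "s < -1"
  shows "(\<lambda>b::int. (1 + real_of_int \<bar>b\<bar>) powr s) summable_on UNIV"
proof -
  have *: "(\<lambda>n::nat. (1 + real n) powr s) summable_on UNIV"
  proof -
    have "summable (\<lambda>n::nat. real n powr s)" using assms by (simp add: summable_real_powr_iff)
    then have "summable (\<lambda>n::nat. real (Suc n) powr s)" by (subst summable_Suc_iff)
    then show ?thesis by (intro norm_summable_imp_summable_on) (simp add: add.commute)
  qed
  have "(\<lambda>b::int. (1 + real_of_int \<bar>b\<bar>) powr s) summable_on range int"
    using * by (subst summable_on_reindex) (auto simp: o_def)
  moreover have "(\<lambda>b::int. (1 + real_of_int \<bar>b\<bar>) powr s) summable_on range (\<lambda>n. - int n)"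
    using * by (subst summable_on_reindex) (auto simp: o_def inj_on_def)
  ultimately have "(\<lambda>b::int. (1 + real_of_int \<bar>b\<bar>) powr s) summable_on (range int \<union> range (\<lambda>n. - int n))"
    by (rule summable_on_union)
  moreover have "range int \<union> range (\<lambda>n. - int n) = UNIV"
    by (auto simp: image_def) (metis int_cases2)
  ultimately show ?thesis by simp
qed

text \<open>The sign of \<open>a\<close> and the divisor \<open>|a|\<close> of \<open>|m|\<close>
  determine \<open>c = m div (4 * a)\<close>; the two signs account for the factor 2. With
  \<open>m = b^2 - D\<close> this counts the forms with middle coefficient \<open>b\<close>.\<close>

lemma card_factorizations_le:
  fixes m :: int
  assumes "m \<noteq> 0"
  shows "finite {(a, c). 4 * a * c = m}"
    and "card {(a, c). 4 * a * c = m} \<le> 2 * card {d. d dvd nat \<bar>m\<bar>}"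
proof -
  let ?D = "{d. d dvd nat \<bar>m\<bar>}"
  let ?f = "\<lambda>(s::bool, d). let a = (if s then int d else - int d) in (a, m div (4 * a))"
  have fin: "finite ?D" using assms by (intro finite_divisors_nat) auto
  have sub: "{(a, c). 4 * a * c = m} \<subseteq> ?f ` (UNIV \<times> ?D)"
  proof
    fix q assume "q \<in> {(a, c). 4 * a * c = m}"
    then obtain a c where q: "q = (a, c)" and m: "m = 4 * a * c" by auto
    have a0: "a \<noteq> 0" using m assms by auto
    have "nat \<bar>a\<bar> dvd nat \<bar>m\<bar>" using m by (simp add: nat_abs_mult_distrib)
    then show "q \<in> ?f ` (UNIV \<times> ?D)"
      using q m a0 by (intro image_eqI[of _ _ "(a \<ge> 0, nat \<bar>a\<bar>)"]) (auto simp: Let_def)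
  qed
  show "finite {(a, c). 4 * a * c = m}"
    by (rule finite_subset[OF sub]) (use fin in auto)
  have "card {(a, c). 4 * a * c = m} \<le> card (UNIV \<times> ?D :: (bool \<times> nat) set)"
    by (rule surj_card_le[OF _ sub]) (use fin in auto)
  then show "card {(a, c). 4 * a * c = m} \<le> 2 * card {d. d dvd nat \<bar>m\<bar>}"
    by (simp add: card_cartesian_product)
qed

text \<open>The forms are fibred over \<open>b\<close>: the divisor bound leaves
  \<open>O(|b|^(2/3))\<close> forms, each of weight about \<open>|b|^(-2)\<close>, so the sum over
  \<open>b\<close> has exponent \<open>-4/3 < -1\<close>.\<close>

lemma summable_on_forms_of_disc:
  assumes nsq: "\<not> (\<exists>m::int. D = m ^ 2)"
  shows "(\<lambda>(a, b, c). 1 / (1 + (real_of_int b) ^ 2)) summable_on forms_of_disc D"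
proof -
  define B where "B = (\<lambda>b::int. {(a, c). 4 * a * c = b ^ 2 - D})"
  define g where "g = (\<lambda>b::int. real (card (B b)) * (1 / (1 + (real_of_int b) ^ 2)))"
  obtain C where C: "\<And>n::nat. n > 0 \<Longrightarrow> card {d. d dvd n} ^ 3 \<le> C * n"
    using card_divisors_cube_le by blast
  \<comment> \<open>Non-squareness keeps the fibres finite: \<open>4 * a * c = 0\<close> would have
    infinitely many solutions.\<close>
  have nz: "b ^ 2 - D \<noteq> 0" for b using nsq by auto
  have fin: "finite (B b)" for b unfolding B_def by (rule card_factorizations_le[OF nz])
  define K where "K = 8 * real C * (1 + real_of_int \<bar>D\<bar>)"
  have K0: "K \<ge> 0" unfolding K_def by simp
  have gle: "g b \<le> 2 * K powr (1/3) * (1 + real_of_int \<bar>b\<bar>) powr (-4/3)" for b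
  proof -
    define t where "t = 1 + real_of_int \<bar>b\<bar>"
    have t1: "t \<ge> 1" unfolding t_def by simp
    have "real (card (B b)) ^ 3 \<le> (2 * real (card {d. d dvd nat \<bar>b ^ 2 - D\<bar>})) ^ 3"
      using card_factorizations_le(2)[OF nz, of b] unfolding B_def by (intro power_mono) linarith+
    also have "\<dots> = 8 * real (card {d. d dvd nat \<bar>b ^ 2 - D\<bar>} ^ 3)" by (simp add: power_mult_distrib)
    also have "\<dots> \<le> 8 * real (C * nat \<bar>b ^ 2 - D\<bar>)"
      using C[of "nat \<bar>b ^ 2 - D\<bar>"] nz[of b] by (intro mult_left_mono of_nat_mono) auto
    also have "\<dots> = 8 * real C * \<bar>real_of_int (b ^ 2 - D)\<bar>" by simp
    also have "\<dots> \<le> 8 * real C * ((1 + real_of_int \<bar>D\<bar>) * t ^ 2)"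
    proof (intro mult_left_mono)
      have "\<bar>real_of_int (b ^ 2 - D)\<bar> \<le> (real_of_int b)^2 + real_of_int \<bar>D\<bar>"
        using abs_triangle_ineq4[of "(real_of_int b)^2" "real_of_int D"] by simp
      also have "\<dots> \<le> t ^ 2 + real_of_int \<bar>D\<bar> * t ^ 2"
      proof (intro add_mono)
        have "\<bar>real_of_int b\<bar> ^ 2 \<le> t ^ 2" unfolding t_def by (intro power_mono) auto
        then show "(real_of_int b)^2 \<le> t ^ 2" by simp
        have "real_of_int \<bar>D\<bar> * 1 \<le> real_of_int \<bar>D\<bar> * t ^ 2"
          using t1 by (intro mult_left_mono) auto
        then show "real_of_int \<bar>D\<bar> \<le> real_of_int \<bar>D\<bar> * t ^ 2" by simp
      qed
      finally show "\<bar>real_of_int (b ^ 2 - D)\<bar> \<le> (1 + real_of_int \<bar>D\<bar>) * t ^ 2" by (simp add: algebra_simps)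
    qed simp
    finally have cube: "real (card (B b)) ^ 3 \<le> K * t ^ 2" unfolding K_def by (simp add: algebra_simps)
    have "real (card (B b)) = (real (card (B b)) ^ 3) powr (1/3)"
      by (cases "card (B b) = 0") (simp_all add: powr_powr flip: powr_numeral)
    also have "\<dots> \<le> (K * t ^ 2) powr (1/3)" using cube by (intro powr_mono2) auto
    also have "\<dots> = K powr (1/3) * t powr (2/3)"
      using K0 t1 by (simp add: powr_mult powr_powr flip: powr_numeral)
    finally have card: "real (card (B b)) \<le> K powr (1/3) * t powr (2/3)" .
    have "t ^ 2 \<le> 2 * (1 + (real_of_int b) ^ 2)"
    proof -
      have "0 \<le> (\<bar>real_of_int b\<bar> - 1) ^ 2" by simp
      then show ?thesis unfolding t_def by (simp add: power2_eq_square algebra_simps)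
    qed
    moreover have "0 < t ^ 2" "0 < 1 + (real_of_int b) ^ 2" using t1 by (auto simp: add_pos_nonneg)
    ultimately have "1 / (1 + (real_of_int b) ^ 2) \<le> 2 / t ^ 2"
      by (simp add: frac_le_eq divide_nonpos_pos field_simps)
    also have "\<dots> = 2 * t powr (-2)" using t1 by (simp add: powr_minus_divide)
    finally have "g b \<le> (K powr (1/3) * t powr (2/3)) * (2 * t powr (-2))"
      unfolding g_def using card by (intro mult_mono) auto
    also have "\<dots> = 2 * K powr (1/3) * t powr (-4/3)" by (simp flip: powr_add)
    finally show ?thesis unfolding t_def .
  qed
  have g_sum: "g summable_on UNIV"
  proof (rule summable_on_comparison_test)
    show "(\<lambda>b. 2 * K powr (1/3) * (1 + real_of_int \<bar>b\<bar>) powr (-4/3)) summable_on UNIV"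
      by (intro summable_on_cmult_right summable_on_int_powr) simp
    show "0 \<le> g b" for b unfolding g_def by simp
  qed (use gle in auto)
  have "(\<lambda>(b, p). 1 / (1 + (real_of_int b) ^ 2)) summable_on Sigma UNIV B"
  proof (rule summable_on_SigmaI[where g = g])
    show "((\<lambda>y. case (b, y) of (b, p) \<Rightarrow> 1 / (1 + (real_of_int b) ^ 2)) has_sum g b) (B b)" for b
      using has_sum_finite[OF fin, of "\<lambda>_. 1 / (1 + (real_of_int b) ^ 2)" b] unfolding g_def by simp
  qed (use g_sum in auto)
  moreover have "inj_on (\<lambda>(b, a, c). (a, b, c)) (Sigma UNIV B)" by (auto simp: inj_on_def)
  moreover have "(\<lambda>(b, a, c). (a, b, c)) ` Sigma UNIV B = forms_of_disc D"
    unfolding B_def forms_of_disc_def by (auto simp: image_def algebra_simps)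
  ultimately show ?thesis
    using summable_on_reindex[of "\<lambda>(b, a, c). (a, b, c)" "Sigma UNIV B" "\<lambda>(a, b, c). 1 / (1 + (real_of_int b) ^ 2)"]
    by (simp add: o_def case_prod_unfold)
qed

subsection \<open>The function \<open>\<psi>\<close>\<close>

text \<open>The substitution \<open>u = sin\<^sup>2 \<theta>\<close> removes the singularity of the integrand at \<open>u = 1\<close>.\<close>

definition sin_power_integral :: "nat \<Rightarrow> real \<Rightarrow> real" where
  "sin_power_integral n \<theta> = integral {0..\<theta>} (\<lambda>t. sin t ^ n)"

lemma sin_power_integral_deriv:
  assumes "0 < \<theta>"
  shows "(sin_power_integral n has_real_derivative sin \<theta> ^ n) (at \<theta>)"
proof -
  have "((\<lambda>\<theta>. integral {0..\<theta>} (\<lambda>t. sin t ^ n)) has_real_derivative sin \<theta> ^ n) (at \<theta> within {0..\<theta> + 1})"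
    using assms by (intro integral_has_real_derivative continuous_intros) auto
  then show ?thesis
    using assms unfolding sin_power_integral_def
    by (subst (asm) at_within_interior) auto
qed

lemma sin_power_integral_continuous: "continuous_on {0..\<theta>} (sin_power_integral n)"
  unfolding sin_power_integral_def
  by (intro indefinite_integral_continuous_1 integrable_continuous_interval continuous_intros)

lemma sin_power_integral_bounds:
  assumes "0 \<le> \<theta>" "\<theta> \<le> pi / 2"
  shows "0 \<le> sin_power_integral n \<theta>" "sin_power_integral n \<theta> \<le> \<theta> * sin \<theta> ^ n"
proof -
  have int: "(\<lambda>t. sin t ^ n) integrable_on {0..\<theta>}"
    by (intro integrable_continuous_interval continuous_intros)
  have pos: "0 \<le> sin t" if "t \<in> {0..\<theta>}" for t
    using that assms pi_gt_zero by (intro sin_ge_zero) (auto simp: field_simps)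
  show "0 \<le> sin_power_integral n \<theta>"
    unfolding sin_power_integral_def using pos by (intro integral_nonneg int) auto
  have "integral {0..\<theta>} (\<lambda>t. sin t ^ n) \<le> integral {0..\<theta>} (\<lambda>t. sin \<theta> ^ n)"
  proof (intro integral_le int)
    show "sin t ^ n \<le> sin \<theta> ^ n" if "t \<in> {0..\<theta>}" for t
      using that assms pos by (intro power_mono sin_monotone_2pi_le) auto
  qed auto
  then show "sin_power_integral n \<theta> \<le> \<theta> * sin \<theta> ^ n"
    unfolding sin_power_integral_def using assms by simp
qed

lemma arcsin_unit_interval:
  assumes "0 \<le> s" "s \<le> 1"
  shows "0 \<le> arcsin s" "arcsin s \<le> pi / 2"
  using assms arcsin_ubound[of s] arcsin_nonneg[of s] by auto

text \<open>For \<open>\<theta> = arcsin (sqrt u)\<close> one has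
  \<open>d\<theta> = du / (2 sqrt u sqrt (1 - u))\<close> and
  \<open>sin \<theta> ^ (2k-2) = u ^ (k-1)\<close>; the product is the integrand of
  \<open>psi\<close> together with its factor 1/2.\<close>

lemma psi_antiderivative_deriv:
  assumes "k \<ge> 1" "0 < u" "u < 1"
  shows "((\<lambda>u. sin_power_integral (2 * k - 2) (arcsin (sqrt u))) has_real_derivative
           1/2 * (u powr (real k - 3/2) * (1 - u) powr (-1/2))) (at u)"
proof -
  have s: "0 < sqrt u" "sqrt u < 1" "- 1 < sqrt u" using assms by (auto intro: less_trans[of _ 0])
  have "0 < arcsin (sqrt u)" using s arcsin_less_arcsin[of 0 "sqrt u"] by simp
  then have "((\<lambda>u. sin_power_integral (2 * k - 2) (arcsin (sqrt u))) has_real_derivative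
      sin (arcsin (sqrt u)) ^ (2 * k - 2) * (inverse (sqrt (1 - (sqrt u)\<^sup>2)) * (inverse (sqrt u) / 2))) (at u)"
    using s assms
    by (intro DERIV_chain2[OF sin_power_integral_deriv] DERIV_chain2[OF DERIV_arcsin] DERIV_real_sqrt) auto
  moreover have "sin (arcsin (sqrt u)) ^ (2 * k - 2) * (inverse (sqrt (1 - (sqrt u)\<^sup>2)) * (inverse (sqrt u) / 2))
      = 1/2 * (u powr (real k - 3/2) * (1 - u) powr (-1/2))"
  proof -
    have "sin (arcsin (sqrt u)) ^ (2 * k - 2) = sqrt u ^ (2 * (k - 1))"
      using s by (simp add: diff_mult_distrib2)
    also have "\<dots> = u ^ (k - 1)" using assms by (simp add: power_mult)
    also have "\<dots> = u powr (real k - 1)" using assms by (simp flip: powr_realpow)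
    finally have 1: "sin (arcsin (sqrt u)) ^ (2 * k - 2) = u powr (real k - 1)" .
    have 2: "inverse (sqrt u) = u powr (-1/2)" using assms by (simp add: powr_minus powr_half_sqrt flip: powr_half_sqrt)
    have 3: "inverse (sqrt (1 - (sqrt u)\<^sup>2)) = (1 - u) powr (-1/2)"
      using assms by (simp add: powr_minus powr_half_sqrt)
    have 4: "u powr (real k - 3/2) = u powr (real k - 1) * u powr (-1/2)"
      by (simp flip: powr_add)
    show ?thesis unfolding 1 2 3 4 by simp
  qed
  ultimately show ?thesis by simp
qed

lemma psi_eq_sin_power_integral:
  assumes "k \<ge> 1" "0 \<le> v" "v \<le> 1"
  shows "psi k v = sin_power_integral (2 * k - 2) (arcsin (sqrt v))"
proof -
  let ?G = "\<lambda>u. sin_power_integral (2 * k - 2) (arcsin (sqrt u))"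
  have "((\<lambda>u. 1/2 * (u powr (real k - 3/2) * (1 - u) powr (-1/2))) has_integral ?G v - ?G 0) {0..v}"
  \<comment> \<open>The derivative is required only in the open interval and continuity at the ends,
    so \<open>v = 1\<close> is covered although the integrand is unbounded near it.\<close>
  proof (rule fundamental_theorem_of_calculus_interior)
    show "continuous_on {0..v} ?G"
    proof (rule continuous_on_compose2[OF sin_power_integral_continuous[of "pi/2"]])
      show "continuous_on {0..v} (\<lambda>u. arcsin (sqrt u))"
        using assms by (intro continuous_intros) (auto intro: order_trans[of _ 0])
      show "(\<lambda>u. arcsin (sqrt u)) ` {0..v} \<subseteq> {0..pi / 2}"
        using assms by (auto simp del: divide_le_eq_numeral1 le_divide_eq_numeral1 intro!: arcsin_unit_interval)
    qed
    show "(?G has_vector_derivative 1/2 * (u powr (real k - 3/2) * (1 - u) powr (-1/2))) (at u)"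
      if "u \<in> {0<..<v}" for u
      using psi_antiderivative_deriv[of k u] that assms
      by (simp add: has_real_derivative_iff_has_vector_derivative)
  qed (use assms in auto)
  from integral_unique[OF this] have "psi k v = ?G v - ?G 0"
    unfolding psi_def integral_mult_right .
  then show ?thesis by (simp add: sin_power_integral_def)
qed

lemma psi_deriv:
  assumes "k \<ge> 1" "0 < v" "v < 1"
  shows "(psi k has_real_derivative 1/2 * (v powr (real k - 3/2) * (1 - v) powr (-1/2))) (at v)"
proof (rule has_field_derivative_transform_within_open[OF psi_antiderivative_deriv[OF assms]])
  show "sin_power_integral (2 * k - 2) (arcsin (sqrt u)) = psi k u" if "u \<in> {0<..<1}" for u
    using that assms by (subst psi_eq_sin_power_integral) auto
qed (use assms in auto)

lemma psi_continuous_on: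
  assumes "k \<ge> 1"
  shows "continuous_on {0..1} (psi k)"
proof -
  have "continuous_on {0..1} (\<lambda>u. sin_power_integral (2 * k - 2) (arcsin (sqrt u)))"
  proof (rule continuous_on_compose2[OF sin_power_integral_continuous[of "pi/2"]])
    show "continuous_on {0..1} (\<lambda>u. arcsin (sqrt u))"
      by (intro continuous_intros) (auto intro: order_trans[of _ 0])
    show "(\<lambda>u. arcsin (sqrt u)) ` {0..1} \<subseteq> {0..pi / 2}"
      by (auto simp del: divide_le_eq_numeral1 le_divide_eq_numeral1 intro!: arcsin_unit_interval)
  qed
  then show ?thesis
    by (rule continuous_on_eq) (use assms in \<open>auto simp: psi_eq_sin_power_integral\<close>)
qed

lemma arctan_le_self:
  fixes x :: real
  assumes "0 \<le> x"
  shows "arctan x \<le> x"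
proof -
  have "0 - arctan 0 \<le> x - arctan x"
  proof (rule DERIV_nonneg_imp_nondecreasing[OF assms])
    show "\<exists>y. ((\<lambda>x. x - arctan x) has_real_derivative y) (at t) \<and> 0 \<le> y" for t
      by (rule exI[of _ "1 - inverse (1 + t\<^sup>2)"])
         (auto intro!: derivative_eq_intros simp: inverse_le_1_iff)
  qed
  then show ?thesis by simp
qed

text \<open>Up to 1/2 the arctangent formula already gives \<open>2 * s\<close>; beyond 1/2 the
  crude bound \<open>arcsin s <= pi/2 < 2\<close> is enough. Only linear order in \<open>s\<close>
  matters, not the constant.\<close>

lemma arcsin_le:
  assumes "0 \<le> s" "s \<le> 1"
  shows "arcsin s \<le> 4 * s"
proof (cases "s \<le> 1/2")
  case True
  have s: "3/4 \<le> 1 - s\<^sup>2" using True assms power_mono[of s "1/2" 2] by (simp add: power2_eq_square)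
  then have "1/2 \<le> sqrt (1 - s\<^sup>2)" by (intro real_le_rsqrt) (simp add: power2_eq_square)
  then have "s / sqrt (1 - s\<^sup>2) \<le> s / (1/2)" using assms s by (intro divide_left_mono mult_pos_pos) auto
  moreover have "0 \<le> s / sqrt (1 - s\<^sup>2)" using s assms by simp
  moreover have "arcsin s = arctan (s / sqrt (1 - s\<^sup>2))" using True assms by (intro arcsin_arctan) auto
  ultimately show ?thesis using arctan_le_self[of "s / sqrt (1 - s\<^sup>2)"] assms by simp
next
  case False
  then show ?thesis using arcsin_ubound[of s] pi_less_4 assms by simp
qed

text \<open>After the substitution \<open>psi\<close> is an integral over an interval of length
  \<open>arcsin s <= 4 * s\<close> of an increasing integrand whose last value is
  \<open>s ^ (2k-2)\<close>. The resulting order of vanishing at 0 is what makes the series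
  converge.\<close>

lemma psi_bounds:
  assumes "k \<ge> 1" "0 \<le> s" "s \<le> 1"
  shows "0 \<le> psi k (s ^ 2)" "psi k (s ^ 2) \<le> 4 * s ^ (2 * k - 1)"
proof -
  have s2: "s ^ 2 \<le> 1" using assms by (simp add: power_le_one)
  have eq: "psi k (s ^ 2) = sin_power_integral (2 * k - 2) (arcsin s)"
    using assms s2 by (subst psi_eq_sin_power_integral) auto
  have a: "0 \<le> arcsin s" "arcsin s \<le> pi / 2" using arcsin_unit_interval[of s] assms by auto
  show "0 \<le> psi k (s ^ 2)" unfolding eq using sin_power_integral_bounds[OF a] by simp
  have "psi k (s ^ 2) \<le> arcsin s * s ^ (2 * k - 2)"
    unfolding eq using sin_power_integral_bounds(2)[OF a, of "2 * k - 2"] assms by simp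
  also have "\<dots> \<le> (4 * s) * s ^ (2 * k - 2)"
    using arcsin_le assms by (intro mult_right_mono) auto
  also have "\<dots> = 4 * s ^ Suc (2 * k - 2)" by simp
  also have "Suc (2 * k - 2) = 2 * k - 1" using assms by simp
  finally show "psi k (s ^ 2) \<le> 4 * s ^ (2 * k - 1)" .
qed

subsection \<open>Convergence\<close>

lemma form_eval_complex:
  "Re (form_eval (a, b, c) z 1) = form_height (a, b, c) z - 2 * of_int a * (Im z)^2"
  "Im (form_eval (a, b, c) z 1) = Im z * (2 * of_int a * Re z + of_int b)"
  by (simp_all add: power2_eq_square cmod_def algebra_simps flip: power2_eq_square)
     (simp_all add: power2_eq_square algebra_simps)

lemma discriminant_real:
  assumes "(a, b, c) \<in> forms_of_disc D"
  shows "(real_of_int b)^2 - 4 * of_int a * of_int c = of_int D"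
  using assms by (auto simp: forms_of_disc_def)

lemma norm_form_eval_sq:
  assumes "Q \<in> forms_of_disc D"
  shows "(cmod (form_eval Q z 1))^2 = (form_height Q z)^2 + of_int D * (Im z)^2"
proof (cases Q)
  case (fields a b c)
  show ?thesis
    using assms unfolding fields cmod_power2 form_eval_complex
    by (subst discriminant_real[symmetric, of a b c D], assumption)
       (unfold form_height.simps cmod_power2, simp add: power2_eq_square algebra_simps)
qed

text \<open>Moving \<open>z\<close> to \<open>\<i>\<close> turns the form into \<open>[a', b', c'] = [a y, 2 a x + b, (a x\<^sup>2 + b x + c) / y]\<close>, and
  \<open>\<bar>Q(z, 1)\<bar>\<^sup>2 / y\<^sup>2 = (c' - a')\<^sup>2 + b'\<^sup>2 = a'\<^sup>2 + c'\<^sup>2 + b'\<^sup>2 / 2 + D / 2\<close> is positive definite in these coefficients.\<close>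

lemma norm_form_eval_sq_ge:
  assumes "(a, b, c) \<in> forms_of_disc D" "D \<ge> 0" "Im z > 0"
  shows "(Im z)^2 * (2 * of_int a * Re z + of_int b)^2 \<le> 2 * (cmod (form_eval (a, b, c) z 1))^2"
    and "(Im z)^4 * (of_int a)^2 \<le> (cmod (form_eval (a, b, c) z 1))^2"
proof -
  define A B C y where "A = real_of_int a * (Im z)^2" and "B = Im z * (2 * of_int a * Re z + of_int b)"
    and "C = of_int a * (Re z)^2 + of_int b * Re z + of_int c" and "y = Im z"
  have disc: "B^2 - 4 * A * C = y^2 * of_int D"
    unfolding discriminant_real[OF assms(1), symmetric] A_def B_def C_def y_def
    by (simp add: power2_eq_square algebra_simps)
  have "(cmod (form_eval (a, b, c) z 1))^2 = (C - A)^2 + B^2"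
    unfolding cmod_power2 form_eval_complex form_height.simps A_def B_def C_def
    by (simp add: power2_eq_square algebra_simps)
  also have "\<dots> = A^2 + C^2 + B^2 / 2 + y^2 * of_int D / 2"
    by (subst disc[symmetric]) (simp add: power2_eq_square field_simps)
  finally have eq: "(cmod (form_eval (a, b, c) z 1))^2 = A^2 + C^2 + B^2 / 2 + y^2 * of_int D / 2" .
  define E where "E = y^2 * of_int D / 2"
  have nn: "0 \<le> A^2" "0 \<le> B^2" "0 \<le> C^2" "0 \<le> E" using assms by (auto simp: E_def)
  note eq = eq[folded E_def]
  have "B^2 \<le> 2 * (cmod (form_eval (a, b, c) z 1))^2" unfolding eq using nn by simp
  then show "(Im z)^2 * (2 * of_int a * Re z + of_int b)^2 \<le> 2 * (cmod (form_eval (a, b, c) z 1))^2"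
    unfolding B_def by (simp add: power_mult_distrib)
  have "A^2 \<le> (cmod (form_eval (a, b, c) z 1))^2" unfolding eq using nn by linarith
  then show "(Im z)^4 * (of_int a)^2 \<le> (cmod (form_eval (a, b, c) z 1))^2"
    unfolding A_def by (simp add: power_mult_distrib mult.commute flip: power_mult)
qed

section \<open>Majorants on vertical strips\<close>

text \<open>The weight sees only \<open>b\<close>, since for fixed \<open>b\<close> the pairs
  \<open>(a, c)\<close> are merely counted. It does not depend on the point of the half plane, which
  gives uniform convergence.\<close>

definition form_weight :: "form \<Rightarrow> real" where
  "form_weight = (\<lambda>(a, b, c). 1 / (1 + (real_of_int b) ^ 2))"

lemma form_weight_pos: "0 < form_weight Q"
  by (cases Q) (auto simp: form_weight_def add_pos_nonneg)

locale nonsquare_disc =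
  fixes D :: int
  assumes D_pos: "D > 0" and D_nonsquare: "\<not> (\<exists>m::int. D = m ^ 2)"
begin

lemma form_weight_summable: "A \<subseteq> forms_of_disc D \<Longrightarrow> form_weight summable_on A"
  using summable_on_subset[OF summable_on_forms_of_disc[OF D_nonsquare]] unfolding form_weight_def by simp

lemma norm_form_eval_ge:
  assumes "Q \<in> forms_of_disc D" "Im z > 0"
  shows "sqrt (of_int D) * Im z \<le> cmod (form_eval Q z 1)"
proof (rule power2_le_imp_le)
  show "(sqrt (of_int D) * Im z)^2 \<le> (cmod (form_eval Q z 1))^2"
    using norm_form_eval_sq[OF assms(1)] D_pos by (simp add: power_mult_distrib)
qed simp

lemma form_eval_nonzero:
  assumes "Q \<in> forms_of_disc D" "Im z > 0"
  shows "form_eval Q z 1 \<noteq> 0"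
proof -
  have "0 < sqrt (of_int D) * Im z" using D_pos assms by simp
  then show ?thesis using norm_form_eval_ge[OF assms] by auto
qed

text \<open>A bound for \<open>(1 + b^2) / |Q|^2\<close> on the strip. With
  \<open>B = 2 a x + b\<close> one has \<open>b^2 <= 2 B^2 + 8 a^2 x^2\<close>. The 5 collects 4
  from \<open>B^2 <= 2 |Q|^2 / \<delta>^2\<close> and 1 from \<open>\<delta>^2 <= |Q|^2\<close>; the
  8 comes from \<open>a^2 <= |Q|^2 / \<delta>^4\<close>. The summand 1 is slack that keeps the
  constant at least 1.\<close>

definition strip_const :: "real \<Rightarrow> real \<Rightarrow> real" where
  "strip_const R \<delta> = 1 + 5 / \<delta>^2 + 8 * R^2 / \<delta>^4"

lemma strip_const_ge_1: "1 \<le> strip_const R \<delta>"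
  unfolding strip_const_def by simp

lemma inverse_form_weight_le:
  assumes "Q \<in> forms_of_disc D" "\<bar>Re z\<bar> \<le> R" "\<delta> \<le> Im z" "\<delta> > 0"
  shows "1 \<le> strip_const R \<delta> * (cmod (form_eval Q z 1))^2 * form_weight Q"
proof (cases Q)
  case (fields a b c)
  define q where "q = (cmod (form_eval Q z 1))^2"
  define B where "B = 2 * of_int a * Re z + real_of_int b"
  have Q: "(a, b, c) \<in> forms_of_disc D" using assms fields by simp
  have z: "Im z > 0" using assms by simp
  have "D \<ge> 1" using D_pos by simp
  then have D1: "1 \<le> real_of_int D" by linarith
  have q0: "q \<ge> 0" unfolding q_def by simp
  have 1: "\<delta>^2 * B^2 \<le> 2 * q"
  proof -
    have "\<delta>^2 * B^2 \<le> (Im z)^2 * B^2" using assms by (intro mult_right_mono power_mono) auto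
    then show ?thesis using norm_form_eval_sq_ge(1)[OF Q _ z] D_pos unfolding q_def B_def fields by simp
  qed
  have 2: "\<delta>^4 * (of_int a)^2 \<le> q"
  proof -
    have "\<delta>^4 * (of_int a)^2 \<le> (Im z)^4 * (real_of_int a)^2" using assms by (intro mult_right_mono power_mono) auto
    then show ?thesis using norm_form_eval_sq_ge(2)[OF Q _ z] D_pos unfolding q_def fields by simp
  qed
  have 3: "\<delta>^2 \<le> q"
  proof -
    have "\<delta>^2 \<le> 1 * (Im z)^2" using assms power_mono[of \<delta> "Im z" 2] by simp
    also have "\<dots> \<le> of_int D * (Im z)^2" using D1 by (intro mult_right_mono) auto
    also have "\<dots> \<le> q" using norm_form_eval_sq[OF assms(1), of z] unfolding q_def by simp
    finally show ?thesis .
  qed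
  have "(real_of_int b)^2 = (B - 2 * of_int a * Re z)^2" unfolding B_def by simp
  also have "\<dots> \<le> 2 * B^2 + 8 * ((of_int a)^2 * (Re z)^2)"
    using zero_le_power2[of "B + 2 * of_int a * Re z"] by (simp add: power2_eq_square algebra_simps)
  also have "\<dots> \<le> 2 * (2 * q / \<delta>^2) + 8 * ((q / \<delta>^4) * R^2)"
  proof (intro add_mono mult_left_mono mult_mono)
    show "B^2 \<le> 2 * q / \<delta>^2" using 1 assms by (simp add: field_simps)
    show "(real_of_int a)^2 \<le> q / \<delta>^4" using 2 assms by (simp add: field_simps)
    show "(Re z)^2 \<le> R^2" using assms power_mono[of "\<bar>Re z\<bar>" R 2] by simp
  qed (use q0 in auto)
  finally have b: "(real_of_int b)^2 \<le> 2 * (2 * q / \<delta>^2) + 8 * ((q / \<delta>^4) * R^2)" .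
  have "1 \<le> q / \<delta>^2" using 3 assms by (simp add: field_simps)
  with b have "1 + (real_of_int b)^2 \<le> 5 * (q / \<delta>^2) + 8 * ((q / \<delta>^4) * R^2)" by simp
  also have "\<dots> \<le> strip_const R \<delta> * q" using q0 unfolding strip_const_def by (simp add: algebra_simps)
  finally have le: "1 + (real_of_int b)^2 \<le> strip_const R \<delta> * q" .
  have "0 < 1 + (real_of_int b)^2" by (simp add: add_pos_nonneg)
  then show ?thesis using le unfolding form_weight_def fields q_def by (simp add: field_simps)
qed

text \<open>For \<open>k = 2\<close> this is the strip estimate in the form
  \<open>1 <= t^2 * form_weight Q\<close>. As the weight is at most 1, this forces
  \<open>t >= 1\<close>, so higher powers of \<open>t\<close> only help.\<close>

lemma inverse_norm_form_eval_power_le: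
  assumes "Q \<in> forms_of_disc D" "\<bar>Re z\<bar> \<le> R" "\<delta> \<le> Im z" "\<delta> > 0" "k \<ge> 2"
  shows "1 / cmod (form_eval Q z 1) ^ k \<le> sqrt (strip_const R \<delta>) ^ k * form_weight Q"
proof -
  define q where "q = cmod (form_eval Q z 1)"
  define t where "t = sqrt (strip_const R \<delta>) * q"
  have z: "Im z > 0" using assms by simp
  have q0: "q > 0" using form_eval_nonzero[OF assms(1) z] unfolding q_def by simp
  have M: "0 < strip_const R \<delta>" using strip_const_ge_1 order.strict_trans2 zero_less_one by blast
  have t2: "1 \<le> t^2 * form_weight Q"
    using inverse_form_weight_le[OF assms(1-4)] M unfolding t_def q_def by (simp add: power_mult_distrib)
  have w1: "form_weight Q \<le> 1" by (cases Q) (auto simp: form_weight_def divide_le_eq_1 add_pos_nonneg)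
  have t0: "0 < t" using q0 M unfolding t_def by simp
  have "t^2 * form_weight Q \<le> t^2 * 1" using w1 by (intro mult_left_mono) auto
  then have "1 \<le> t^2" using t2 by simp
  then have t1: "1 \<le> t" using t0 power_le_one_iff[of t 2] by (smt (verit) one_le_power power2_nonneg_ge_1_iff abs_of_pos)
  have "1 \<le> t^2 * form_weight Q" by (rule t2)
  also have "\<dots> \<le> t^k * form_weight Q"
    using t1 assms form_weight_pos[of Q] by (intro mult_right_mono power_increasing) auto
  also have "\<dots> = sqrt (strip_const R \<delta>) ^ k * form_weight Q * q^k" unfolding t_def by (simp add: power_mult_distrib)
  finally show ?thesis using q0 unfolding q_def by (simp add: pos_divide_le_eq)
qed

text \<open>With \<open>s = sqrt D * y / |Q|\<close> the argument of \<open>psi\<close> is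
  \<open>s^2\<close>, and \<open>|Q|^(k-1) * s^(2k-1)\<close> equals
  \<open>(sqrt D * y)^(2k-1) / |Q|^k\<close>.\<close>

lemma norm_F_summand_le:
  assumes "Q \<in> forms_of_disc D" "Im z > 0" "k \<ge> 1"
  shows "cmod (F_summand k D z Q) \<le> 4 * (sqrt (of_int D) * Im z) ^ (2 * k - 1) * (1 / cmod (form_eval Q z 1) ^ k)"
proof -
  define q where "q = cmod (form_eval Q z 1)"
  define s where "s = sqrt (of_int D) * Im z / q"
  have q0: "q > 0" using form_eval_nonzero[OF assms(1,2)] unfolding q_def by simp
  have s: "0 \<le> s" "s \<le> 1" using norm_form_eval_ge[OF assms(1,2)] q0 D_pos assms unfolding s_def q_def by auto
  have s2: "real_of_int D * (Im z)^2 / q^2 = s^2" unfolding s_def using D_pos by (simp add: power_mult_distrib power_divide)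
  note psi = psi_bounds[OF assms(3) s]
  have sg: "\<bar>sgn (form_height Q z)\<bar> \<le> 1" by (simp add: sgn_real_def)
  have "cmod (F_summand k D z Q) = \<bar>sgn (form_height Q z)\<bar> * q ^ (k - 1) * psi k (s^2)"
    unfolding F_summand_def using psi by (simp add: norm_mult norm_power s2 flip: q_def)
  also have "\<dots> \<le> 1 * q ^ (k - 1) * (4 * s ^ (2 * k - 1))"
    using psi sg q0 by (intro mult_mono) auto
  also have "\<dots> = 4 * (sqrt (of_int D) * Im z) ^ (2 * k - 1) * (q ^ (k - 1) / q ^ (2 * k - 1))"
    unfolding s_def by (simp add: power_divide)
  also have "q ^ (k - 1) / q ^ (2 * k - 1) = 1 / q ^ k"
  proof -
    have "2 * k - 1 = (k - 1) + k" using assms by simp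
    then have "q ^ (2 * k - 1) = q ^ (k - 1) * q ^ k" by (simp only: power_add)
    then show ?thesis using q0 by simp
  qed
  finally show ?thesis unfolding q_def .
qed

lemma norm_F_summand_le_weight:
  assumes "Q \<in> forms_of_disc D" "\<bar>Re z\<bar> \<le> R" "\<delta> \<le> Im z" "\<delta> > 0" "k \<ge> 2"
  shows "cmod (F_summand k D z Q)
    \<le> (4 * sqrt (of_int D) ^ (2 * k - 1) * sqrt (strip_const R \<delta>) ^ k) * Im z ^ (2 * k - 1) * form_weight Q"
proof -
  have "cmod (F_summand k D z Q) \<le> 4 * (sqrt (of_int D) * Im z) ^ (2 * k - 1) * (1 / cmod (form_eval Q z 1) ^ k)"
    using assms by (intro norm_F_summand_le) auto
  also have "\<dots> \<le> 4 * (sqrt (of_int D) * Im z) ^ (2 * k - 1) * (sqrt (strip_const R \<delta>) ^ k * form_weight Q)"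
    using assms D_pos by (intro mult_left_mono inverse_norm_form_eval_power_le) auto
  finally show ?thesis by (simp add: power_mult_distrib mult_ac)
qed

lemma F_summand_summable:
  assumes "A \<subseteq> forms_of_disc D" "Im z > 0" "k \<ge> 2"
  shows "F_summand k D z summable_on A"
proof (rule abs_summable_summable, rule summable_on_comparison_test)
  define C where "C = (4 * sqrt (of_int D) ^ (2 * k - 1) * sqrt (strip_const \<bar>Re z\<bar> (Im z)) ^ k) * Im z ^ (2 * k - 1)"
  show "(\<lambda>Q. C * form_weight Q) summable_on A"
    by (intro summable_on_cmult_right form_weight_summable assms)
  show "norm (F_summand k D z Q) \<le> C * form_weight Q" if "Q \<in> A" for Q
    unfolding C_def using that assms by (intro norm_F_summand_le_weight) auto
qed auto

end

subsection \<open>Modularity and growth\<close>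

fun sl2_mult :: "int \<times> int \<times> int \<times> int \<Rightarrow> int \<times> int \<times> int \<times> int \<Rightarrow> int \<times> int \<times> int \<times> int" where
  "sl2_mult (a, b, c, d) (a', b', c', d') = (a * a' + b * c', a * b' + b * d', c * a' + d * c', c * b' + d * d')"

fun sl2_inv :: "int \<times> int \<times> int \<times> int \<Rightarrow> int \<times> int \<times> int \<times> int" where
  "sl2_inv (a, b, c, d) = (d, - b, - c, a)"

lemma sl2_mult_mem: "g \<in> SL2Z \<Longrightarrow> h \<in> SL2Z \<Longrightarrow> sl2_mult g h \<in> SL2Z"
proof -
  assume "g \<in> SL2Z" "h \<in> SL2Z"
  moreover obtain a b c d a' b' c' d' where "g = (a, b, c, d)" "h = (a', b', c', d')"
    by (metis prod_cases4)
  moreover have "(a * a' + b * c') * (c * b' + d * d') - (a * b' + b * d') * (c * a' + d * c')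
      = (a * d - b * c) * (a' * d' - b' * c')"
    by (simp add: algebra_simps)
  ultimately show ?thesis by (simp add: SL2Z_def)
qed

lemma sl2_inv_mem: "g \<in> SL2Z \<Longrightarrow> sl2_inv g \<in> SL2Z"
  by (auto simp: SL2Z_def algebra_simps)

lemma form_act_mult: "form_act (form_act Q g) h = form_act Q (sl2_mult g h)"
proof -
  obtain a b c d a' b' c' d' p q r where "g = (a, b, c, d)" "h = (a', b', c', d')" "Q = (p, q, r)"
    by (metis prod_cases4 prod_cases3)
  then show ?thesis by (simp add: power2_eq_square algebra_simps)
qed

lemma sl2_mult_inv:
  assumes "g \<in> SL2Z"
  shows "sl2_mult g (sl2_inv g) = (1, 0, 0, 1)" "sl2_mult (sl2_inv g) g = (1, 0, 0, 1)"
  using assms by (auto simp: SL2Z_def algebra_simps)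

lemma form_act_one: "form_act Q (1, 0, 0, 1) = Q"
  by (cases Q) simp

lemma form_act_disc:
  assumes "Q \<in> forms_of_disc D" "g \<in> SL2Z"
  shows "form_act Q g \<in> forms_of_disc D"
proof -
  obtain a b c d p q r where eq: "g = (a, b, c, d)" "Q = (p, q, r)" by (metis prod_cases4 prod_cases3)
  have "(2 * p * a * b + q * (a * d + b * c) + 2 * r * c * d)^2
      - 4 * (p * a^2 + q * a * c + r * c^2) * (p * b^2 + q * b * d + r * d^2)
      = (a * d - b * c)^2 * (q^2 - 4 * p * r)"
    by (simp add: power2_eq_square algebra_simps)
  then show ?thesis using assms unfolding eq by (simp add: SL2Z_def forms_of_disc_def)
qed

lemma narrow_class_subset: "narrow_class D A \<Longrightarrow> A \<subseteq> forms_of_disc D"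
  unfolding narrow_class_def using form_act_disc by blast

text \<open>An orbit is stable under right multiplication and \<open>sl2_inv g\<close> undoes
  \<open>g\<close>; this is the reindexing of the sum that yields modularity.\<close>

lemma narrow_class_act_bij:
  assumes "narrow_class D A" "g \<in> SL2Z"
  shows "bij_betw (\<lambda>Q. form_act Q g) A A"
proof -
  obtain Q0 where A: "A = form_act Q0 ` SL2Z" using assms by (auto simp: narrow_class_def)
  have closed: "form_act Q h \<in> A" if "Q \<in> A" "h \<in> SL2Z" for Q h
    using that unfolding A by (auto simp: form_act_mult intro: sl2_mult_mem)
  show ?thesis
  proof (rule bij_betw_byWitness[where f' = "\<lambda>Q. form_act Q (sl2_inv g)"])
    show "\<forall>Q\<in>A. form_act (form_act Q g) (sl2_inv g) = Q" "\<forall>Q\<in>A. form_act (form_act Q (sl2_inv g)) g = Q"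
      by (simp_all add: form_act_mult sl2_mult_inv[OF assms(2)] form_act_one)
    show "(\<lambda>Q. form_act Q g) ` A \<subseteq> A" "(\<lambda>Q. form_act Q (sl2_inv g)) ` A \<subseteq> A"
      using closed assms sl2_inv_mem by (blast, blast)
  qed
qed

section \<open>Transformation of the summands under Moebius maps\<close>

lemma automorphy_factor_nonzero:
  assumes "(a, b, c, d) \<in> SL2Z" "Im z > 0"
  shows "of_int c * z + of_int d \<noteq> 0"
proof
  assume eq: "of_int c * z + of_int d = 0"
  then have "Im (of_int c * z + of_int d) = 0" by simp
  then have "c = 0" using assms by simp
  with eq have "d = 0" by simp
  with \<open>c = 0\<close> show False using assms by (simp add: SL2Z_def)
qed

lemma Im_moebius:
  assumes "(a, b, c, d) \<in> SL2Z"
  shows "Im (moebius_act (a, b, c, d) z) = Im z / (cmod (of_int c * z + of_int d))^2"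
proof -
  have "real_of_int a * of_int d - of_int b * of_int c = 1"
    using assms by (auto simp: SL2Z_def simp flip: of_int_mult of_int_diff)
  then have "(of_int a * Im z) * (of_int c * Re z + of_int d) - (of_int a * Re z + of_int b) * (of_int c * Im z) = Im z"
    by algebra
  then show ?thesis by (simp add: Im_divide cmod_power2)
qed

lemma form_eval_moebius:
  assumes "(a, b, c, d) \<in> SL2Z" "Im z > 0"
  shows "form_eval Q (moebius_act (a, b, c, d) z) 1
       = form_eval (form_act Q (a, b, c, d)) z 1 / (of_int c * z + of_int d)^2"
proof -
  obtain p q r where Q: "Q = (p, q, r)" by (metis prod_cases3)
  have hom: "form_eval Q (n / j) 1 = form_eval Q n j / j^2" if "j \<noteq> 0" for n j :: complex
    unfolding Q using that by (simp add: field_simps power2_eq_square)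
  show ?thesis
    unfolding form_eval_form_act using hom[OF automorphy_factor_nonzero[OF assms]] by simp
qed

text \<open>The height is the Hermitian form \<open>p |n|^2 + q Re (n * cnj j) + r |j|^2\<close> at
  \<open>n = z\<close>, \<open>j = 1\<close>, and it scales by \<open>1 / |j|^2\<close> when both
  entries are divided by \<open>j\<close>. The factor is positive, so the sign of the height is
  preserved.\<close>

lemma form_height_moebius:
  assumes "(a, b, c, d) \<in> SL2Z" "Im z > 0"
  shows "form_height Q (moebius_act (a, b, c, d) z)
       = form_height (form_act Q (a, b, c, d)) z / (cmod (of_int c * z + of_int d))^2"
proof -
  obtain p q r where Q: "Q = (p, q, r)" by (metis prod_cases3)
  define n j where "n = of_int a * z + of_int b" and "j = of_int c * z + of_int d"
  have j: "(cmod j)^2 \<noteq> 0" using automorphy_factor_nonzero[OF assms] by (simp add: j_def)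
  have "form_height Q (n / j) = (of_int p * (cmod n)^2 + of_int q * Re (n * cnj j) + of_int r * (cmod j)^2) / (cmod j)^2"
  proof -
    have "Re (n / j) = Re (n * cnj j) / (cmod j)^2" by (simp add: Re_divide cmod_power2)
    then show ?thesis unfolding Q form_height.simps norm_divide power_divide
      using j by (simp add: field_simps)
  qed
  also have "of_int p * (cmod n)^2 + of_int q * Re (n * cnj j) + of_int r * (cmod j)^2
      = form_height (form_act Q (a, b, c, d)) z"
    unfolding Q n_def j_def form_act.simps form_height.simps cmod_power2
    by (simp add: power2_eq_square algebra_simps)
  finally show ?thesis unfolding n_def j_def by simp
qed

text \<open>The sign and the argument of \<open>psi\<close> are invariant, so the automorphy factor
  comes from \<open>Q ^ (k-1)\<close> alone: each of the \<open>k - 1\<close> factors contributes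
  \<open>(c z + d)^(-2)\<close>.\<close>

lemma F_summand_moebius:
  assumes "(a, b, c, d) \<in> SL2Z" "Im z > 0" "k \<ge> 1"
  shows "(of_int c * z + of_int d) ^ (2 * k - 2) * F_summand k D (moebius_act (a, b, c, d) z) Q
       = F_summand k D z (form_act Q (a, b, c, d))"
proof -
  define j where "j = of_int c * z + of_int d"
  define q where "q = form_eval (form_act Q (a, b, c, d)) z 1"
  have j: "j \<noteq> 0" using automorphy_factor_nonzero[OF assms(1,2)] by (simp add: j_def)
  have sg: "sgn (x / (cmod j)^2) = sgn x" for x :: real using j by (simp add: sgn_divide)
  have v: "of_int D * (Im z / (cmod j)^2)^2 / (cmod (q / j^2))^2 = of_int D * (Im z)^2 / (cmod q)^2"
    using j by (simp add: norm_divide norm_power power_divide flip: power_mult)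
  have "2 * k - 2 = 2 * (k - 1)" by simp
  then have eq: "j ^ (2 * k - 2) * (q / j^2) ^ (k - 1) = q ^ (k - 1)"
    using j by (simp only: power_mult power_divide) simp
  show ?thesis
    unfolding F_summand_def form_eval_moebius[OF assms(1,2)] form_height_moebius[OF assms(1,2)] Im_moebius[OF assms(1)]
      j_def[symmetric] q_def[symmetric] sg v eq[symmetric]
    by (simp only: mult_ac)
qed

lemma F_class_modular:
  assumes "narrow_class D A" "g \<in> SL2Z" "Im z > 0" "k \<ge> 1"
  shows "slash (2 - 2 * int k) (F_class k D A) g z = F_class k D A z"
proof -
  obtain a b c d where g: "g = (a, b, c, d)" by (metis prod_cases4)
  define C where "C = complex_of_real ((-1)^k * real_of_int D powr (1/2 - real k) / (real ((2 * k - 2) choose (k - 1)) * pi))"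
  have gm: "(a, b, c, d) \<in> SL2Z" using assms g by simp
  have e: "- (2 - 2 * int k) = int (2 * k - 2)" using assms by (simp add: of_nat_diff)
  have "slash (2 - 2 * int k) (F_class k D A) g z
      = C * ((of_int c * z + of_int d) ^ (2 * k - 2) * (\<Sum>\<^sub>\<infinity>Q\<in>A. F_summand k D (moebius_act g z) Q))"
    unfolding g slash.simps F_class_def C_def[symmetric] e power_int_of_nat by (simp add: mult_ac)
  also have "(of_int c * z + of_int d) ^ (2 * k - 2) * (\<Sum>\<^sub>\<infinity>Q\<in>A. F_summand k D (moebius_act g z) Q)
      = (\<Sum>\<^sub>\<infinity>Q\<in>A. (of_int c * z + of_int d) ^ (2 * k - 2) * F_summand k D (moebius_act g z) Q)"
    by (rule infsum_cmult_right'[symmetric])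
  also have "\<dots> = (\<Sum>\<^sub>\<infinity>Q\<in>A. F_summand k D z (form_act Q g))"
    unfolding g using F_summand_moebius[OF gm assms(3,4)] by simp
  also have "\<dots> = (\<Sum>\<^sub>\<infinity>Q\<in>A. F_summand k D z Q)"
    by (rule infsum_reindex_bij_betw[OF narrow_class_act_bij[OF assms(1,2)]])
  finally show ?thesis unfolding F_class_def C_def .
qed

section \<open>Growth towards the cusp\<close>

context nonsquare_disc begin

lemma F_class_translate:
  assumes "narrow_class D A" "Im z > 0" "k \<ge> 1"
  shows "F_class k D A (z + of_int n) = F_class k D A z"
  using F_class_modular[OF assms(1) _ assms(2,3), of "(1, n, 0, 1)"] by (simp add: SL2Z_def)

lemma F_class_growth:
  assumes "narrow_class D A" "k \<ge> 2"
  shows "polynomial_growth_at_ii_inf (F_class k D A)"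
proof -
  define C0 where "C0 = cmod (complex_of_real ((-1)^k * real_of_int D powr (1/2 - real k) / (real ((2 * k - 2) choose (k - 1)) * pi)))"
  define C where "C = 4 * sqrt (of_int D) ^ (2 * k - 1) * sqrt (strip_const 1 1) ^ k"
  define S where "S = (\<Sum>\<^sub>\<infinity>Q\<in>A. form_weight Q)"
  have A: "A \<subseteq> forms_of_disc D" using assms narrow_class_subset by blast
  note fw = form_weight_summable[OF A]
  have main: "cmod (F_class k D A z) \<le> C0 * (C * S) * Im z ^ (2 * k - 1)" if z: "Im z \<ge> 1" "\<bar>Re z\<bar> \<le> 1" for z
  proof -
    have "cmod (\<Sum>\<^sub>\<infinity>Q\<in>A. F_summand k D z Q) \<le> (\<Sum>\<^sub>\<infinity>Q\<in>A. C * Im z ^ (2 * k - 1) * form_weight Q)"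
    proof (rule norm_infsum_le)
      show "(F_summand k D z has_sum (\<Sum>\<^sub>\<infinity>Q\<in>A. F_summand k D z Q)) A"
        using F_summand_summable[OF A] assms z by simp
      show "((\<lambda>Q. C * Im z ^ (2 * k - 1) * form_weight Q) has_sum (\<Sum>\<^sub>\<infinity>Q\<in>A. C * Im z ^ (2 * k - 1) * form_weight Q)) A"
        using fw by (intro has_sum_infsum summable_on_cmult_right)
      show "norm (F_summand k D z Q) \<le> C * Im z ^ (2 * k - 1) * form_weight Q" if "Q \<in> A" for Q
        unfolding C_def using that z A assms by (intro norm_F_summand_le_weight) auto
    qed
    also have "\<dots> = C * Im z ^ (2 * k - 1) * S" unfolding S_def by (rule infsum_cmult_right')
    finally have "C0 * cmod (\<Sum>\<^sub>\<infinity>Q\<in>A. F_summand k D z Q) \<le> C0 * (C * Im z ^ (2 * k - 1) * S)"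
      by (intro mult_left_mono) (auto simp: C0_def)
    then show ?thesis unfolding F_class_def norm_mult C0_def by (simp add: mult_ac)
  qed
  show ?thesis unfolding polynomial_growth_at_ii_inf_def
  proof (intro exI conjI allI impI)
    show "(1::real) > 0" by simp
    fix z assume z: "Im z \<ge> 1"
    \<comment> \<open>The majorant is uniform only for bounded \<open>x\<close>; this translation
      moves \<open>x\<close> into \<open>[0, 1)\<close>, where the single constant
      \<open>strip_const 1 1\<close> applies.\<close>
    define n where "n = - \<lfloor>Re z\<rfloor>"
    have "\<bar>Re (z + of_int n)\<bar> \<le> 1" unfolding n_def by simp linarith
    then have "cmod (F_class k D A (z + of_int n)) \<le> C0 * (C * S) * Im (z + of_int n) ^ (2 * k - 1)"
      using z by (intro main) auto
    then show "cmod (F_class k D A z) \<le> C0 * (C * S) * Im z ^ (2 * k - 1)"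
      using F_class_translate[OF assms(1), of z k n] z assms by simp
  qed
qed

end

subsection \<open>Sums of products of holomorphic and antiholomorphic functions\<close>

text \<open>Real analyticity at one point with coefficients and radius made explicit, so that sums,
  conjugates and products can be formed with a common radius.\<close>

definition double_power_series :: "(nat \<Rightarrow> nat \<Rightarrow> complex) \<Rightarrow> real \<Rightarrow> (real \<Rightarrow> real \<Rightarrow> complex) \<Rightarrow> bool" where
  "double_power_series c r f \<longleftrightarrow> (\<forall>s t. \<bar>s\<bar> < r \<and> \<bar>t\<bar> < r \<longrightarrow>
     ((\<lambda>(m, n). c m n * of_real s ^ m * of_real t ^ n) has_sum f s t) UNIV)"

lemma double_power_series_add:
  assumes "double_power_series c r f" "double_power_series d r g"
  shows "double_power_series (\<lambda>m n. c m n + d m n) r (\<lambda>s t. f s t + g s t)"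
  unfolding double_power_series_def
proof (intro allI impI)
  fix s t assume "\<bar>s\<bar> < r \<and> \<bar>t\<bar> < r"
  then have "((\<lambda>x. (case x of (m, n) \<Rightarrow> c m n * of_real s ^ m * of_real t ^ n) +
      (case x of (m, n) \<Rightarrow> d m n * of_real s ^ m * of_real t ^ n)) has_sum f s t + g s t) UNIV"
    using assms unfolding double_power_series_def by (intro has_sum_add) auto
  then show "((\<lambda>(m, n). (c m n + d m n) * of_real s ^ m * of_real t ^ n) has_sum f s t + g s t) UNIV"
    by (simp add: case_prod_unfold distrib_right)
qed

lemma double_power_series_sum:
  assumes "finite I" "\<And>i. i \<in> I \<Longrightarrow> double_power_series (c i) r (f i)"
  shows "double_power_series (\<lambda>m n. \<Sum>i\<in>I. c i m n) r (\<lambda>s t. \<Sum>i\<in>I. f i s t)"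
  using assms
proof (induction I rule: finite_induct)
  case empty
  then show ?case by (simp add: double_power_series_def case_prod_unfold)
next
  case (insert i I)
  then show ?case using double_power_series_add[of "c i" r "f i"] by simp
qed

lemma double_power_series_cnj:
  assumes "double_power_series c r f"
  shows "double_power_series (\<lambda>m n. cnj (c m n)) r (\<lambda>s t. cnj (f s t))"
  unfolding double_power_series_def
proof (intro allI impI)
  fix s t assume "\<bar>s\<bar> < r \<and> \<bar>t\<bar> < r"
  then have "((\<lambda>x. cnj (case x of (m, n) \<Rightarrow> c m n * of_real s ^ m * of_real t ^ n)) has_sum cnj (f s t)) UNIV"
    using assms unfolding double_power_series_def has_sum_cnj_iff by auto
  then show "((\<lambda>(m, n). cnj (c m n) * of_real s ^ m * of_real t ^ n) has_sum cnj (f s t)) UNIV"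
    by (simp add: case_prod_unfold)
qed

text \<open>The Cauchy product in two variables: both families are absolutely summable, so the
  products of their terms may be regrouped by total exponents.\<close>

lemma double_power_series_mult:
  assumes "double_power_series c r f" "double_power_series d r g"
  shows "double_power_series (\<lambda>m n. \<Sum>(i, j)\<in>{..m} \<times> {..n}. c i j * d (m - i) (n - j)) r (\<lambda>s t. f s t * g s t)"
  unfolding double_power_series_def
proof (intro allI impI)
  fix s t assume st: "\<bar>s\<bar> < r \<and> \<bar>t\<bar> < r"
  define a where "a = (\<lambda>(m, n). c m n * of_real s ^ m * of_real t ^ n)"
  define b where "b = (\<lambda>(m, n). d m n * of_real s ^ m * of_real t ^ n)"
  have a: "(a has_sum f s t) UNIV" and b: "(b has_sum g s t) UNIV"
    using assms st unfolding double_power_series_def a_def b_def by auto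
  have "((\<lambda>(x, y). a x * b y) has_sum f s t * g s t) (UNIV \<times> UNIV)"
  proof (rule has_sum_SigmaI)
    show "((\<lambda>y. case (x, y) of (x, y) \<Rightarrow> a x * b y) has_sum a x * g s t) UNIV" for x
      using has_sum_cmult_right[OF b] by simp
    show "((\<lambda>x. a x * g s t) has_sum f s t * g s t) UNIV"
      using a by (rule has_sum_cmult_left)
    have an: "(\<lambda>x. norm (a x)) summable_on UNIV" and bn: "(\<lambda>x. norm (b x)) summable_on UNIV"
      using a b has_sum_imp_summable summable_on_iff_abs_summable_on_complex by blast+
    have "(\<lambda>x. norm (case x of (x, y) \<Rightarrow> a x * b y)) summable_on Sigma UNIV (\<lambda>_. UNIV)"
    proof (rule summable_on_SigmaI)
      show "((\<lambda>y. norm (case (x, y) of (x, y) \<Rightarrow> a x * b y)) has_sum norm (a x) * (\<Sum>\<^sub>\<infinity>y. norm (b y))) UNIV" for x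
        using has_sum_cmult_right[OF has_sum_infsum[OF bn]] by (simp add: norm_mult)
      show "(\<lambda>x. norm (a x) * (\<Sum>\<^sub>\<infinity>y. norm (b y))) summable_on UNIV"
        using an by (rule summable_on_cmult_left)
    qed auto
    then show "(\<lambda>(x, y). a x * b y) summable_on Sigma UNIV (\<lambda>_. UNIV)"
      by (rule abs_summable_summable)
  qed
  \<comment> \<open>In the new index \<open>(m, n)\<close> are the total exponents and
    \<open>(i, j)\<close> those taken from the first series.\<close>
  also have "?this \<longleftrightarrow> ((\<lambda>((m, n), (i, j)). a (i, j) * b (m - i, n - j)) has_sum f s t * g s t)
      (Sigma UNIV (\<lambda>(m, n). {..m} \<times> {..n}))"
    by (rule has_sum_reindex_bij_witness[where
          i = "\<lambda>((m, n), (i, j)). ((i, j), (m - i, n - j))" and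
          j = "\<lambda>((i, j), (m, n)). ((i + m, j + n), (i, j))"]) auto
  finally have "((\<lambda>(m, n). \<Sum>(i, j)\<in>{..m} \<times> {..n}. a (i, j) * b (m - i, n - j)) has_sum f s t * g s t) UNIV"
  proof (rule has_sum_SigmaD, goal_cases)
    case (1 x)
    show ?case by (cases x) simp
  qed
  moreover have "(\<Sum>(i, j)\<in>{..m} \<times> {..n}. a (i, j) * b (m - i, n - j))
      = (\<Sum>(i, j)\<in>{..m} \<times> {..n}. c i j * d (m - i) (n - j)) * of_real s ^ m * of_real t ^ n" for m n
    unfolding sum_distrib_right
  proof (rule sum.cong, goal_cases)
    case (2 x)
    then obtain i j where x: "x = (i, j)" "i \<le> m" "j \<le> n" by auto
    then have e: "of_real s ^ m = (of_real s ^ i * of_real s ^ (m - i) :: complex)"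
      "of_real t ^ n = (of_real t ^ j * of_real t ^ (n - j) :: complex)"
      by (simp_all flip: power_add)
    show ?case unfolding x(1) a_def b_def e by simp
  qed simp
  ultimately show "((\<lambda>(m, n). (\<Sum>(i, j)\<in>{..m} \<times> {..n}. c i j * d (m - i) (n - j)) * of_real s ^ m * of_real t ^ n)
      has_sum f s t * g s t) UNIV"
    by simp
qed

text \<open>Each \<open>(s + \<i> t)^m\<close> in the Taylor series is expanded binomially. The
  norms of the resulting terms add up to the Taylor series of norms at \<open>|s| + |t|\<close>,
  which must stay below \<open>r\<close>; hence the radius \<open>r / 2\<close>.\<close>

lemma holomorphic_double_power_series:
  assumes "f holomorphic_on ball z r" "r > 0"
  shows "\<exists>c. double_power_series c (r / 2) (\<lambda>s t. f (z + Complex s t))"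
proof -
  define a where "a = (\<lambda>n. (deriv ^^ n) f z / fact n)"
  have ser: "(\<lambda>n. a n * w ^ n) sums f (z + w)" if "norm w < r" for w
    using holomorphic_power_series[OF assms(1), of "z + w"] that by (simp add: a_def dist_norm)
  have "double_power_series (\<lambda>i j. a (i + j) * of_nat ((i + j) choose i) * \<i> ^ j) (r / 2) (\<lambda>s t. f (z + Complex s t))"
    unfolding double_power_series_def
  proof (intro allI impI)
    fix s t :: real assume st: "\<bar>s\<bar> < r / 2 \<and> \<bar>t\<bar> < r / 2"
    define \<sigma> where "\<sigma> = \<bar>s\<bar> + \<bar>t\<bar>"
    define g where "g = (\<lambda>(m, i). a m * of_nat (m choose i) * of_real s ^ i * (\<i> * of_real t) ^ (m - i))"
    have \<sigma>: "0 \<le> \<sigma>" "\<sigma> < r" using st unfolding \<sigma>_def by auto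
    have "summable (\<lambda>n. norm (a n * of_real \<sigma> ^ n))"
    proof (rule powser_insidea)
      show "summable (\<lambda>n. a n * of_real ((\<sigma> + r) / 2) ^ n)"
        using \<sigma> by (intro sums_summable[OF ser]) (simp only: norm_of_real, simp)
      show "norm (of_real \<sigma> :: complex) < norm (of_real ((\<sigma> + r) / 2) :: complex)"
        using \<sigma> by (simp only: norm_of_real) simp
    qed
    then have "(\<lambda>n. norm (a n) * \<sigma> ^ n) summable_on UNIV"
      using \<sigma> by (intro norm_summable_imp_summable_on) (simp add: norm_mult norm_power)
    then have "(\<lambda>x. norm (g x)) summable_on (Sigma UNIV (\<lambda>m. {..m}))"
    proof (rule summable_on_SigmaI[rotated])
      fix m :: nat
      have "norm (a m) * \<sigma> ^ m = (\<Sum>i\<in>{..m}. norm (g (m, i)))"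
        unfolding \<sigma>_def binomial_ring g_def
        by (simp add: sum_distrib_left norm_mult norm_power mult_ac)
      then show "((\<lambda>i. norm (g (m, i))) has_sum norm (a m) * \<sigma> ^ m) {..m}"
        by (simp add: has_sum_finite)
    qed auto
    then have sg: "g summable_on (Sigma UNIV (\<lambda>m. {..m}))" by (rule abs_summable_summable)
    have row: "(\<Sum>i\<in>{..m}. g (m, i)) = a m * Complex s t ^ m" for m
    proof -
      have "Complex s t = of_real s + \<i> * of_real t" by (simp add: Complex_eq)
      then show ?thesis unfolding binomial_ring g_def by (simp add: binomial_ring sum_distrib_left mult_ac)
    qed
    have "(g has_sum f (z + Complex s t)) (Sigma UNIV (\<lambda>m. {..m}))"
    proof (rule has_sum_SigmaI[OF _ _ sg])
      show "((\<lambda>i. g (m, i)) has_sum a m * Complex s t ^ m) {..m}" for m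
        by (simp add: has_sum_finite flip: row)
      have "norm (Complex s t) \<le> \<sigma>" unfolding \<sigma>_def using cmod_le[of "Complex s t"] by simp
      then have "(\<lambda>m. a m * Complex s t ^ m) sums f (z + Complex s t)"
        using \<sigma> by (intro ser) auto
      moreover have "summable (\<lambda>m. norm (a m * Complex s t ^ m))"
      proof (rule summable_comparison_test')
        show "summable (\<lambda>n. norm (a n * of_real \<sigma> ^ n))" by fact
        show "norm (norm (a n * Complex s t ^ n)) \<le> norm (a n * of_real \<sigma> ^ n)" if "n \<ge> 0" for n
          using \<open>norm (Complex s t) \<le> \<sigma>\<close> \<sigma> by (simp add: norm_mult norm_power mult_left_mono power_mono)
      qed
      ultimately show "((\<lambda>m. a m * Complex s t ^ m) has_sum f (z + Complex s t)) UNIV"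
        by (intro norm_summable_imp_has_sum)
    qed
    also have "?this \<longleftrightarrow> ((\<lambda>(i, j). a (i + j) * of_nat ((i + j) choose i) * \<i> ^ j * of_real s ^ i * of_real t ^ j)
        has_sum f (z + Complex s t)) UNIV"
      by (rule has_sum_reindex_bij_witness[where i = "\<lambda>(i, j). (i + j, i)" and j = "\<lambda>(m, i). (i, m - i)"])
         (auto simp: g_def power_mult_distrib)
    finally show "((\<lambda>(i, j). a (i + j) * of_nat ((i + j) choose i) * \<i> ^ j * of_real s ^ i * of_real t ^ j)
        has_sum f (z + Complex s t)) UNIV" .
  qed
  then show ?thesis by blast
qed

section \<open>Wirtinger calculus and the Laplacian\<close>

lemma partial_eqI:
  assumes "(F has_derivative F') (at z)"
  shows "partial_x F z = F' 1" "partial_y F z = F' \<i>"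
proof -
  interpret bounded_linear F' using assms by (rule has_derivative_bounded_linear)
  have *: "vector_derivative (\<lambda>s. F (z + v * of_real s)) (at 0) = F' v" for v
  proof (rule vector_derivative_at)
    have "((\<lambda>s::real. z + v * of_real s) has_derivative (\<lambda>s. v * of_real s)) (at 0)"
      by (auto intro!: derivative_eq_intros)
    then have "((\<lambda>s::real. F (z + v * of_real s)) has_derivative (\<lambda>s. F' (v * of_real s))) (at 0)"
      by (rule has_derivative_compose) (simp add: assms)
    moreover have "F' (v * of_real s) = s *\<^sub>R F' v" for s :: real
    proof -
      have "v * of_real s = s *\<^sub>R v" by (simp add: scaleR_conv_of_real mult.commute)
      then show ?thesis by (simp only: scaleR)
    qed
    ultimately show "((\<lambda>s::real. F (z + v * of_real s)) has_vector_derivative F' v) (at 0)"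
      by (simp add: has_vector_derivative_def)
  qed
  show "partial_x F z = F' 1" "partial_y F z = F' \<i>"
    unfolding partial_x_def partial_y_def using *[of 1] *[of \<i>] by simp_all
qed


text \<open>The coefficients of \<open>d\<close> and \<open>cnj d\<close> are the two Wirtinger
  derivatives, the first acting on \<open>g\<close> only and the second on \<open>h\<close>
  only.\<close>

lemma has_derivative_mult_cnj:
  assumes "g field_differentiable at z" "h field_differentiable at z"
  shows "((\<lambda>z. g z * cnj (h z)) has_derivative
    (\<lambda>d. deriv g z * cnj (h z) * d + g z * cnj (deriv h z) * cnj d)) (at z)"
proof -
  have "(g has_derivative (\<lambda>d. deriv g z * d)) (at z)" "(h has_derivative (\<lambda>d. deriv h z * d)) (at z)"
    using assms by (simp_all add: DERIV_deriv_iff_field_differentiable has_field_derivative_imp_has_derivative)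
  then have "((\<lambda>z. g z * cnj (h z)) has_derivative (\<lambda>d. g z * cnj (deriv h z * d) + deriv g z * d * cnj (h z))) (at z)"
    by (intro has_derivative_mult has_derivative_cnj)
  then show ?thesis by (simp add: algebra_simps)
qed

lemma has_derivative_sum_mult_cnj:
  assumes "\<And>i. i \<in> I \<Longrightarrow> g i field_differentiable at z" "\<And>i. i \<in> I \<Longrightarrow> h i field_differentiable at z"
  shows "((\<lambda>z. \<Sum>i\<in>I. g i z * cnj (h i z)) has_derivative
    (\<lambda>d. (\<Sum>i\<in>I. deriv (g i) z * cnj (h i z)) * d + (\<Sum>i\<in>I. g i z * cnj (deriv (h i) z)) * cnj d)) (at z)"
proof -
  have "((\<lambda>z. \<Sum>i\<in>I. g i z * cnj (h i z)) has_derivative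
    (\<lambda>d. \<Sum>i\<in>I. deriv (g i) z * cnj (h i z) * d + g i z * cnj (deriv (h i) z) * cnj d)) (at z)"
    using assms by (intro has_derivative_sum has_derivative_mult_cnj)
  then show ?thesis by (simp add: sum.distrib sum_distrib_right)
qed

text \<open>In Wirtinger derivatives \<open>partial_xx + partial_yy\<close> is 4 times the mixed
  derivative and \<open>partial_x + \<i> partial_y\<close> is 2 times the
  \<open>cnj\<close>-derivative. The former differentiates both factors of each product, the latter
  only the conjugated one.\<close>

lemma hyperbolic_laplacian_sum_holomorphic_cnj:
  fixes g h :: "'i \<Rightarrow> complex \<Rightarrow> complex"
  assumes U: "open U" and z: "z \<in> U"
    and g: "\<And>i. i \<in> I \<Longrightarrow> g i holomorphic_on U" and h: "\<And>i. i \<in> I \<Longrightarrow> h i holomorphic_on U"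
    and F: "\<And>z. z \<in> U \<Longrightarrow> F z = (\<Sum>i\<in>I. g i z * cnj (h i z))"
  shows "hyperbolic_laplacian \<kappa> F z =
      - 4 * of_real ((Im z)^2) * (\<Sum>i\<in>I. deriv (g i) z * cnj (deriv (h i) z))
      + 2 * \<i> * of_int \<kappa> * of_real (Im z) * (\<Sum>i\<in>I. g i z * cnj (deriv (h i) z))"
proof -
  \<comment> \<open>\<open>L\<close> takes both families as arguments, so the first-order formula
    \<open>dL\<close> can be applied again to the differentiated families.\<close>
  define L where "L = (\<lambda>(g :: 'i \<Rightarrow> complex \<Rightarrow> complex) h z. \<Sum>i\<in>I. g i z * cnj (h i z))"
  have fd: "f field_differentiable at w" if "f holomorphic_on U" "w \<in> U" for f w
    using that U holomorphic_on_imp_differentiable_at by blast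
  have dL: "(L g h has_derivative (\<lambda>d. L (\<lambda>i. deriv (g i)) h w * d + L g (\<lambda>i. deriv (h i)) w * cnj d)) (at w)"
    if "w \<in> U" "\<And>i. i \<in> I \<Longrightarrow> g i holomorphic_on U" "\<And>i. i \<in> I \<Longrightarrow> h i holomorphic_on U" for g h :: "'i \<Rightarrow> complex \<Rightarrow> complex" and w
    unfolding L_def using that by (intro has_derivative_sum_mult_cnj fd)
  let ?g' = "\<lambda>i. deriv (g i)" and ?h' = "\<lambda>i. deriv (h i)"
  let ?g'' = "\<lambda>i. deriv (?g' i)" and ?h'' = "\<lambda>i. deriv (?h' i)"
  have g': "?g' i holomorphic_on U" if "i \<in> I" for i using that U g by (simp add: holomorphic_deriv)
  have h': "?h' i holomorphic_on U" if "i \<in> I" for i using that U h by (simp add: holomorphic_deriv)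
  have F1: "(F has_derivative (\<lambda>d. L ?g' h w * d + L g ?h' w * cnj d)) (at w)" if "w \<in> U" for w
    by (rule has_derivative_transform_within_open[OF dL[OF that g h] U that]) (auto simp: F L_def)
  have px: "partial_x F w = L ?g' h w + L g ?h' w" and py: "partial_y F w = \<i> * (L ?g' h w - L g ?h' w)"
    if "w \<in> U" for w
    using partial_eqI[OF F1[OF that]] by (simp_all add: algebra_simps)
  note d1 = dL[OF z g' h] and d2 = dL[OF z g h']
  have "(partial_x F has_derivative (\<lambda>d. (L ?g'' h z * d + L ?g' ?h' z * cnj d) + (L ?g' ?h' z * d + L g ?h'' z * cnj d))) (at z)"
    by (rule has_derivative_transform_within_open[OF has_derivative_add[OF d1 d2] U z]) (auto simp: px)
  from partial_eqI(1)[OF this]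
  have pxx: "partial_x (partial_x F) z = L ?g'' h z + 2 * L ?g' ?h' z + L g ?h'' z" by simp
  have "(partial_y F has_derivative (\<lambda>d. \<i> * ((L ?g'' h z * d + L ?g' ?h' z * cnj d) - (L ?g' ?h' z * d + L g ?h'' z * cnj d)))) (at z)"
    by (rule has_derivative_transform_within_open[OF has_derivative_mult_right[OF has_derivative_diff[OF d1 d2]] U z]) (auto simp: py)
  from partial_eqI(2)[OF this]
  have pyy: "partial_y (partial_y F) z = - L ?g'' h z + 2 * L ?g' ?h' z - L g ?h'' z"
    by (simp add: algebra_simps)
  have "partial_x F z + \<i> * partial_y F z = 2 * L g ?h' z"
    unfolding px[OF z] py[OF z] by (simp add: algebra_simps)
  then have "hyperbolic_laplacian \<kappa> F z = - 4 * of_real ((Im z)^2) * L ?g' ?h' z + 2 * \<i> * of_int \<kappa> * of_real (Im z) * L g ?h' z"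
    unfolding hyperbolic_laplacian_def pxx pyy by (simp add: algebra_simps)
  then show ?thesis unfolding L_def .
qed

lemma real_analytic_on_sum_holomorphic_cnj:
  assumes I: "finite I" and U: "open U"
    and g: "\<And>i. i \<in> I \<Longrightarrow> g i holomorphic_on U" and h: "\<And>i. i \<in> I \<Longrightarrow> h i holomorphic_on U"
    and F: "\<And>z. z \<in> U \<Longrightarrow> F z = (\<Sum>i\<in>I. g i z * cnj (h i z))"
  shows "real_analytic_on F U"
  unfolding real_analytic_on_def
proof
  fix z assume "z \<in> U"
  then obtain r where r: "r > 0" "ball z r \<subseteq> U" using U open_contains_ball by blast
  have "\<forall>i\<in>I. \<exists>c. double_power_series c (r / 2) (\<lambda>s t. g i (z + Complex s t))"
    using holomorphic_double_power_series[OF holomorphic_on_subset[OF g r(2)] r(1)] by blast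
  then obtain c where c: "\<And>i. i \<in> I \<Longrightarrow> double_power_series (c i) (r / 2) (\<lambda>s t. g i (z + Complex s t))"
    unfolding bchoice_iff by blast
  have "\<forall>i\<in>I. \<exists>d. double_power_series d (r / 2) (\<lambda>s t. h i (z + Complex s t))"
    using holomorphic_double_power_series[OF holomorphic_on_subset[OF h r(2)] r(1)] by blast
  then obtain d where d: "\<And>i. i \<in> I \<Longrightarrow> double_power_series (d i) (r / 2) (\<lambda>s t. h i (z + Complex s t))"
    unfolding bchoice_iff by blast
  have "\<exists>e. double_power_series e (r / 2) (\<lambda>s t. \<Sum>i\<in>I. g i (z + Complex s t) * cnj (h i (z + Complex s t)))"
    by (rule exI, rule double_power_series_sum[OF I], rule double_power_series_mult[OF c double_power_series_cnj[OF d]])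
  then obtain e where e: "double_power_series e (r / 2) (\<lambda>s t. \<Sum>i\<in>I. g i (z + Complex s t) * cnj (h i (z + Complex s t)))"
    by blast
  have "z + Complex s t \<in> U" if "\<bar>s\<bar> < r / 2 \<and> \<bar>t\<bar> < r / 2" for s t
  proof -
    have "norm (Complex s t) < r" using cmod_le[of "Complex s t"] that by simp
    then show ?thesis using r(2) by (auto simp: dist_norm)
  qed
  then show "\<exists>r>0. \<exists>coef. \<forall>s t. \<bar>s\<bar> < r \<and> \<bar>t\<bar> < r \<longrightarrow>
      ((\<lambda>(m, n). coef m n * of_real s ^ m * of_real t ^ n) has_sum F (z + Complex s t)) UNIV"
    using e r(1) F unfolding double_power_series_def
    by (intro exI[of _ "r / 2"] conjI exI[of _ e]) auto
qed

subsection \<open>Eichler integrals\<close>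

text \<open>Holomorphy is local, so it suffices to pass to the limit on a closed ball around each
  point.\<close>

lemma holomorphic_on_uniform_limit_open:
  assumes S: "open S" and hol: "eventually (\<lambda>X. f X holomorphic_on S) F"
    and lim: "uniform_limit S f g F" and F: "F \<noteq> bot"
  shows "g holomorphic_on S"
proof -
  have "g field_differentiable at z" if "z \<in> S" for z
  proof -
    have "\<exists>r>0. cball z r \<subseteq> S" using open_contains_cball_eq[OF S] that by simp
    then obtain r where r: "r > 0" "cball z r \<subseteq> S" by blast
    have ev: "\<forall>\<^sub>F X in F. continuous_on (cball z r) (f X) \<and> f X holomorphic_on ball z r"
      using hol
    proof (rule eventually_mono)
      fix X assume "f X holomorphic_on S"
      then have "f X holomorphic_on cball z r" using r(2) by (rule holomorphic_on_subset)
      then show "continuous_on (cball z r) (f X) \<and> f X holomorphic_on ball z r"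
        by (intro conjI holomorphic_on_imp_continuous_on holomorphic_on_subset[OF _ ball_subset_cball])
    qed
    have "uniform_limit (cball z r) f g F" using lim r(2) by (rule uniform_limit_on_subset)
    from holomorphic_uniform_limit[OF ev this F] have "g holomorphic_on ball z r" .
    then show ?thesis by (rule holomorphic_on_imp_differentiable_at) (use r(1) in simp_all)
  qed
  then show ?thesis unfolding holomorphic_on_def by (blast intro: field_differentiable_at_within)
qed

text \<open>The primitive of \<open>w ^ j * q w\<close> that vanishes at \<open>z0\<close>. Straight
  segments suffice because it is used only on balls centred at \<open>z0\<close>.\<close>

definition moment_primitive :: "complex \<Rightarrow> nat \<Rightarrow> (complex \<Rightarrow> complex) \<Rightarrow> complex \<Rightarrow> complex" where
  "moment_primitive z0 j q z = contour_integral (linepath z0 z) (\<lambda>w. w ^ j * q w)"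

text \<open>Up to conjugation this is \<open>\<integral> (cnj z - w)\<^sup>n q(w) dw\<close> from \<open>z0\<close> to \<open>z\<close>, the non-holomorphic Eichler
  integral of \<open>q\<close>; the binomial expansion exhibits it as a sum of products of holomorphic and
  antiholomorphic functions.\<close>

definition eichler_integral :: "complex \<Rightarrow> nat \<Rightarrow> (complex \<Rightarrow> complex) \<Rightarrow> complex \<Rightarrow> complex" where
  "eichler_integral z0 n q z =
     (\<Sum>j\<le>n. (of_nat (n choose j) * (-1) ^ j * z ^ (n - j)) * cnj (moment_primitive z0 j q z))"

lemma closed_segment_center_subset_ball:
  fixes z0 :: "'a::real_normed_vector"
  assumes "z \<in> ball z0 r"
  shows "closed_segment z0 z \<subseteq> ball z0 r"
proof -
  have "0 \<le> dist z0 z" by simp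
  also have "\<dots> < r" using assms by simp
  finally show ?thesis using assms by (intro closed_segment_subset) auto
qed

lemma moment_primitive_deriv:
  assumes "q holomorphic_on ball z0 r" "z \<in> ball z0 r"
  shows "(moment_primitive z0 j q has_field_derivative z ^ j * q z) (at z)"
proof -
  have hol: "(\<lambda>w. w ^ j * q w) holomorphic_on ball z0 r" by (intro holomorphic_intros assms)
  have r: "r > 0" using assms(2) by (auto intro: le_less_trans[OF zero_le_dist])
  have "((\<lambda>x. contour_integral (linepath z0 x) (\<lambda>w. w ^ j * q w)) has_field_derivative z ^ j * q z) (at z)"
  proof (rule triangle_contour_integrals_starlike_primitive[OF holomorphic_on_imp_continuous_on[OF hol]])
    show "z0 \<in> ball z0 r" using r by simp
    show "closed_segment z0 y \<subseteq> ball z0 r" if "y \<in> ball z0 r" for y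
      using that by (rule closed_segment_center_subset_ball)
    show "contour_integral (linepath z0 b) (\<lambda>w. w ^ j * q w) + contour_integral (linepath b c) (\<lambda>w. w ^ j * q w)
        + contour_integral (linepath c z0) (\<lambda>w. w ^ j * q w) = 0"
      if "closed_segment b c \<subseteq> ball z0 r" for b c
    proof -
      have "b \<in> ball z0 r" "c \<in> ball z0 r" using that by auto
      then have "convex hull {z0, b, c} \<subseteq> ball z0 r" using r by (intro hull_minimal) auto
      then have "((\<lambda>w. w ^ j * q w) has_contour_integral 0) (linepath z0 b +++ linepath b c +++ linepath c z0)"
        by (intro Cauchy_theorem_triangle holomorphic_on_subset[OF hol])
      then show ?thesis by (rule has_chain_integral_chain_integral3)
    qed
  qed (use assms in auto)
  then show ?thesis unfolding moment_primitive_def by simp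
qed

lemma moment_primitive_holomorphic:
  assumes "q holomorphic_on ball z0 r"
  shows "moment_primitive z0 j q holomorphic_on ball z0 r"
  using moment_primitive_deriv[OF assms] by (subst holomorphic_on_open[OF open_ball]) blast

lemma deriv_moment_primitive:
  assumes "q holomorphic_on ball z0 r" "z \<in> ball z0 r"
  shows "deriv (moment_primitive z0 j q) z = z ^ j * q z"
  using moment_primitive_deriv[OF assms] by (rule DERIV_imp_deriv)

text \<open>On the segment \<open>|w| <= |z0| + r\<close>, and its length is at most
  \<open>r\<close>. The linear dependence on \<open>\<epsilon>\<close> lets uniform limits of
  \<open>q\<close> pass through the Eichler integral.\<close>

lemma moment_primitive_diff_le:
  assumes "p holomorphic_on ball z0 r" "q holomorphic_on ball z0 r" "z \<in> ball z0 r"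
    and "\<And>w. w \<in> ball z0 r \<Longrightarrow> norm (p w - q w) \<le> \<epsilon>" "0 \<le> \<epsilon>"
  shows "norm (moment_primitive z0 j p z - moment_primitive z0 j q z) \<le> ((norm z0 + r) ^ j * r) * \<epsilon>"
proof -
  have seg: "closed_segment z0 z \<subseteq> ball z0 r" using assms(3) by (rule closed_segment_center_subset_ball)
  have r: "r > 0" using assms(3) by (auto intro: le_less_trans[OF zero_le_dist])
  have int: "(\<lambda>w. w ^ j * f w) contour_integrable_on linepath z0 z" if "f holomorphic_on ball z0 r" for f
    using that seg
    by (intro contour_integrable_continuous_linepath continuous_intros holomorphic_on_imp_continuous_on)
       (auto intro: holomorphic_on_subset)
  have "moment_primitive z0 j p z - moment_primitive z0 j q z
      = contour_integral (linepath z0 z) (\<lambda>w. w ^ j * p w - w ^ j * q w)"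
    unfolding moment_primitive_def by (intro contour_integral_diff[symmetric] int assms)
  also have "norm \<dots> \<le> ((norm z0 + r) ^ j * \<epsilon>) * norm (z - z0)"
  proof (rule contour_integral_bound_linepath)
    show "(\<lambda>w. w ^ j * p w - w ^ j * q w) contour_integrable_on linepath z0 z"
      by (intro contour_integrable_diff int assms)
    show "norm (w ^ j * p w - w ^ j * q w) \<le> (norm z0 + r) ^ j * \<epsilon>" if "w \<in> closed_segment z0 z" for w
    proof -
      have w: "w \<in> ball z0 r" using that seg by blast
      have "norm w \<le> norm z0 + norm (w - z0)" by (rule norm_triangle_sub)
      then have nw: "norm w \<le> norm z0 + r" using w by (simp add: dist_norm norm_minus_commute)
      have "norm (w ^ j * p w - w ^ j * q w) = norm w ^ j * norm (p w - q w)"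
        by (simp add: norm_mult norm_power flip: right_diff_distrib)
      also have "\<dots> \<le> (norm z0 + r) ^ j * \<epsilon>"
        using nw w assms(4) by (intro mult_mono power_mono) (use r in auto)
      finally show ?thesis .
    qed
  qed (use r assms in auto)
  also have "\<dots> \<le> ((norm z0 + r) ^ j * \<epsilon>) * r"
    using assms r by (intro mult_left_mono) (auto simp: dist_norm norm_minus_commute)
  finally show ?thesis by (simp add: mult_ac)
qed

lemma uniform_limit_eichler_integral:
  assumes hol: "eventually (\<lambda>X. qX X holomorphic_on ball z0 r) F" and q: "q holomorphic_on ball z0 r"
    and lim: "uniform_limit (ball z0 r) qX q F" and r: "r > 0"
  shows "uniform_limit (ball z0 r) (\<lambda>X. eichler_integral z0 n (qX X)) (eichler_integral z0 n q) F"
proof (rule uniform_limitI)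
  fix \<epsilon> :: real assume \<epsilon>: "\<epsilon> > 0"
  define K where "K = (\<Sum>j\<le>n. norm (of_nat (n choose j) * (-1::complex) ^ j) * (norm z0 + r) ^ (n - j) * ((norm z0 + r) ^ j * r))"
  have K: "K \<ge> 0" unfolding K_def using r by (intro sum_nonneg mult_nonneg_nonneg) auto
  \<comment> \<open>The shift to \<open>K + 1\<close> avoids division by zero and makes
    \<open>K * \<delta> < \<epsilon>\<close> strict.\<close>
  define \<delta> where "\<delta> = \<epsilon> / (K + 1)"
  have \<delta>: "\<delta> > 0" "K * \<delta> < \<epsilon>" using K \<epsilon> by (auto simp: \<delta>_def field_simps)
  have "\<forall>\<^sub>F X in F. \<forall>w\<in>ball z0 r. dist (qX X w) (q w) < \<delta>" using lim \<delta>(1) by (rule uniform_limitD)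
  with hol show "\<forall>\<^sub>F X in F. \<forall>z\<in>ball z0 r. dist (eichler_integral z0 n (qX X) z) (eichler_integral z0 n q z) < \<epsilon>"
  proof eventually_elim
    case (elim X)
    show ?case
    proof
      fix z assume z: "z \<in> ball z0 r"
      have nz: "norm z \<le> norm z0 + r" using z norm_triangle_sub[of z z0] by (simp add: dist_norm norm_minus_commute)
      have "dist (eichler_integral z0 n (qX X) z) (eichler_integral z0 n q z)
          = norm (\<Sum>j\<le>n. (of_nat (n choose j) * (-1) ^ j * z ^ (n - j)) *
              cnj (moment_primitive z0 j (qX X) z - moment_primitive z0 j q z))"
        unfolding eichler_integral_def dist_norm by (simp add: right_diff_distrib sum_subtractf)
      also have "\<dots> \<le> (\<Sum>j\<le>n. norm ((of_nat (n choose j) * (-1) ^ j * z ^ (n - j)) *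
              cnj (moment_primitive z0 j (qX X) z - moment_primitive z0 j q z)))"
        by (rule norm_sum)
      also have "\<dots> \<le> (\<Sum>j\<le>n. norm (of_nat (n choose j) * (-1::complex) ^ j) * (norm z0 + r) ^ (n - j)
              * (((norm z0 + r) ^ j * r) * \<delta>))"
        unfolding norm_mult norm_power complex_mod_cnj
        using nz elim \<delta> q z r
        by (intro sum_mono mult_mono power_mono moment_primitive_diff_le) (auto simp: dist_norm less_imp_le)
      also have "\<dots> = K * \<delta>" unfolding K_def by (simp add: sum_distrib_left sum_distrib_right mult_ac)
      finally show "dist (eichler_integral z0 n (qX X) z) (eichler_integral z0 n q z) < \<epsilon>" using \<delta> by simp
    qed
  qed
qed

lemma binomial_ring_diff:
  fixes x y :: "'a::comm_ring_1"
  shows "(\<Sum>j\<le>n. of_nat (n choose j) * (-1) ^ j * x ^ (n - j) * y ^ j) = (x - y) ^ n"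
proof -
  have "(x - y) ^ n = (- y + x) ^ n" by simp
  also have "\<dots> = (\<Sum>j\<le>n. of_nat (n choose j) * (- y) ^ j * x ^ (n - j))" by (rule binomial_ring)
  also have "\<dots> = (\<Sum>j\<le>n. of_nat (n choose j) * (-1) ^ j * x ^ (n - j) * y ^ j)"
    by (intro sum.cong refl) (simp add: power_minus[of y] mult_ac)
  finally show ?thesis ..
qed

text \<open>The binomial identity differentiated in \<open>x\<close> with \<open>y\<close> fixed. At
  \<open>y = cnj z\<close> it evaluates the mixed second derivative of an Eichler integral.\<close>

lemma binomial_ring_diff_deriv:
  fixes x y :: complex
  shows "(\<Sum>j\<le>n. deriv (\<lambda>x. of_nat (n choose j) * (-1) ^ j * x ^ (n - j)) x * y ^ j) = of_nat n * (x - y) ^ (n - 1)"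
proof -
  have "((\<lambda>x. \<Sum>j\<le>n. of_nat (n choose j) * (-1) ^ j * x ^ (n - j) * y ^ j) has_field_derivative
      (\<Sum>j\<le>n. deriv (\<lambda>x. of_nat (n choose j) * (-1) ^ j * x ^ (n - j)) x * y ^ j)) (at x)"
    by (intro DERIV_sum DERIV_cmult_right iffD2[OF DERIV_deriv_iff_field_differentiable] derivative_intros)
  then have "((\<lambda>x. (x - y) ^ n) has_field_derivative
      (\<Sum>j\<le>n. deriv (\<lambda>x. of_nat (n choose j) * (-1) ^ j * x ^ (n - j)) x * y ^ j)) (at x)"
    unfolding binomial_ring_diff .
  moreover have "((\<lambda>x. (x - y) ^ n) has_field_derivative of_nat n * (x - y) ^ (n - 1)) (at x)"
    by (auto intro!: derivative_eq_intros)
  ultimately show ?thesis by (rule DERIV_unique)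
qed

text \<open>The \<open>cnj\<close>-derivative falls on the moments, giving
  \<open>cnj z ^ j * cnj (q z)\<close>, and the binomial formula reassembles
  \<open>(z - cnj z)^n\<close>. The coefficient \<open>a\<close> is left open because only the
  \<open>cnj d\<close> part has to match that of the summands.\<close>

lemma eichler_integral_has_derivative:
  assumes q: "q holomorphic_on ball z0 r" and z: "z \<in> ball z0 r"
  obtains a where "(eichler_integral z0 n q has_derivative (\<lambda>d. a * d + (z - cnj z) ^ n * cnj (q z) * cnj d)) (at z)"
proof -
  let ?g = "\<lambda>j z. of_nat (n choose j) * (-1) ^ j * z ^ (n - j) :: complex"
  have "((\<lambda>z. \<Sum>j\<le>n. ?g j z * cnj (moment_primitive z0 j q z)) has_derivative
    (\<lambda>d. (\<Sum>j\<le>n. deriv (?g j) z * cnj (moment_primitive z0 j q z)) * d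
      + (\<Sum>j\<le>n. ?g j z * cnj (deriv (moment_primitive z0 j q) z)) * cnj d)) (at z)"
    using moment_primitive_deriv[OF q z]
    by (intro has_derivative_sum_mult_cnj)
       (auto simp: field_differentiable_def intro!: derivative_eq_intros)
  moreover have "(\<Sum>j\<le>n. ?g j z * cnj (deriv (moment_primitive z0 j q) z)) = (z - cnj z) ^ n * cnj (q z)"
    unfolding deriv_moment_primitive[OF q z] binomial_ring_diff[symmetric]
    by (simp add: sum_distrib_left sum_distrib_right mult_ac)
  ultimately show thesis
    using that unfolding eichler_integral_def by simp
qed

text \<open>The hypothesis on \<open>F\<close> is the integrated form of \<open>\<partial>F/\<partial>cnj z = \<kappa> (2 \<i> y)\<^sup>n cnj q\<close>.\<close>

lemma holomorphic_plus_eichler_integral: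
  assumes F: "\<And>z. z \<in> ball z0 r \<Longrightarrow> F z = H z + \<kappa> * eichler_integral z0 n q z"
    and H: "H holomorphic_on ball z0 r" and q: "q holomorphic_on ball z0 r" and n: "n \<ge> 1"
  shows "real_analytic_on F (ball z0 r)"
    and "z \<in> ball z0 r \<Longrightarrow> hyperbolic_laplacian (- int n) F z = 0"
proof -
  \<comment> \<open>The extra index \<open>Suc n\<close> carries \<open>H\<close> with partner 1, so
    that \<open>F\<close> is one sum of products of the required shape.\<close>
  define g where "g = (\<lambda>j z. if j = Suc n then H z else \<kappa> * (of_nat (n choose j) * (-1) ^ j * z ^ (n - j)))"
  define h where "h = (\<lambda>j. if j = Suc n then (\<lambda>_. 1) else moment_primitive z0 j q)"
  have g: "g j holomorphic_on ball z0 r" for j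
    unfolding g_def using H by (cases "j = Suc n") (auto intro!: holomorphic_intros)
  have h: "h j holomorphic_on ball z0 r" for j
    unfolding h_def using moment_primitive_holomorphic[OF q] by auto
  have Fsum: "F z = (\<Sum>j\<le>Suc n. g j z * cnj (h j z))" if "z \<in> ball z0 r" for z
    using F[OF that] unfolding g_def h_def eichler_integral_def by (simp add: sum_distrib_left mult_ac)
  show "real_analytic_on F (ball z0 r)"
    by (rule real_analytic_on_sum_holomorphic_cnj[OF _ open_ball g h Fsum]) auto
  show "hyperbolic_laplacian (- int n) F z = 0" if z: "z \<in> ball z0 r"
  proof -
    let ?y = "complex_of_real (Im z)"
    have zz: "z - cnj z = 2 * \<i> * ?y" by (simp add: complex_eq_iff)
    have hd: "deriv (h (Suc n)) z = 0" "\<And>j. j \<le> n \<Longrightarrow> deriv (h j) z = z ^ j * q z"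
      unfolding h_def using deriv_moment_primitive[OF q z] by auto
    have gd: "deriv (g j) z = \<kappa> * deriv (\<lambda>x. of_nat (n choose j) * (-1) ^ j * x ^ (n - j)) z" if "j \<le> n" for j
      unfolding g_def using that
      by (auto intro!: deriv_cmult simp: field_differentiable_mult field_differentiable_power)
    have 1: "(\<Sum>j\<le>Suc n. deriv (g j) z * cnj (deriv (h j) z)) = \<kappa> * cnj (q z) * (of_nat n * (z - cnj z) ^ (n - 1))"
      unfolding binomial_ring_diff_deriv[symmetric]
      by (simp add: hd gd sum_distrib_left mult_ac)
    have 2: "(\<Sum>j\<le>Suc n. g j z * cnj (deriv (h j) z)) = \<kappa> * cnj (q z) * (z - cnj z) ^ n"
      unfolding binomial_ring_diff[symmetric]
      by (simp add: hd g_def sum_distrib_left mult_ac)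
    obtain m where m: "n = Suc m" using n by (cases n) auto
    have "hyperbolic_laplacian (- int n) F z =
      - 4 * of_real ((Im z)^2) * (\<kappa> * cnj (q z) * (of_nat n * (z - cnj z) ^ (n - 1)))
      + 2 * \<i> * of_int (- int n) * ?y * (\<kappa> * cnj (q z) * (z - cnj z) ^ n)"
      unfolding 1[symmetric] 2[symmetric]
      by (rule hyperbolic_laplacian_sum_holomorphic_cnj[OF open_ball z g h Fsum])
    \<comment> \<open>With \<open>z - cnj z = 2 \<i> y\<close> both terms are multiples of
      \<open>n (2 \<i> y)^(n-1)\<close>, with factors \<open>-4 y^2\<close> and
      \<open>-2 \<i> y * 2 \<i> y = 4 y^2\<close>.\<close>
    also have "\<dots> = 0"
      unfolding zz m by (simp add: power2_eq_square algebra_simps)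
    finally show ?thesis .
  qed
qed

text \<open>No second derivative of the series is taken. For a finite partial sum the
  \<open>cnj d\<close> terms cancel against those of the Eichler integral of the matching partial
  sum of \<open>q\<close>, so the difference is holomorphic; both pieces converge uniformly, hence
  the limit \<open>H\<close> is holomorphic too.\<close>

lemma real_analytic_harmonic_infsum:
  fixes f q :: "'a \<Rightarrow> complex \<Rightarrow> complex"
  assumes r: "r > 0" and n: "n \<ge> 1" and M: "M summable_on A"
    and fM: "\<And>x z. x \<in> A \<Longrightarrow> z \<in> ball z0 r \<Longrightarrow> norm (f x z) \<le> M x"
    and qM: "\<And>x z. x \<in> A \<Longrightarrow> z \<in> ball z0 r \<Longrightarrow> norm (q x z) \<le> M x"
    and q: "\<And>x. x \<in> A \<Longrightarrow> q x holomorphic_on ball z0 r"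
    and f: "\<And>x z. x \<in> A \<Longrightarrow> z \<in> ball z0 r \<Longrightarrow>
      \<exists>a. (f x has_derivative (\<lambda>d. a * d + \<kappa> * (z - cnj z) ^ n * cnj (q x z) * cnj d)) (at z)"
    and F: "\<And>z. z \<in> ball z0 r \<Longrightarrow> F z = C * (\<Sum>\<^sub>\<infinity>x\<in>A. f x z)"
  shows "real_analytic_on F (ball z0 r)"
    and "z \<in> ball z0 r \<Longrightarrow> hyperbolic_laplacian (- int n) F z = 0"
proof -
  let ?B = "ball z0 r" and ?F = "finite_subsets_at_top A"
  define fX where "fX = (\<lambda>X z. \<Sum>x\<in>X. f x z)"
  define qX where "qX = (\<lambda>X z. \<Sum>x\<in>X. q x z)"
  define q0 where "q0 = (\<lambda>z. \<Sum>\<^sub>\<infinity>x\<in>A. q x z)"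
  define f0 where "f0 = (\<lambda>z. \<Sum>\<^sub>\<infinity>x\<in>A. f x z)"
  define H where "H = (\<lambda>z. f0 z - \<kappa> * eichler_integral z0 n q0 z)"
  have flim: "uniform_limit ?B fX f0 ?F" unfolding fX_def f0_def
    by (rule Weierstrass_m_test_general[OF fM M])
  have qlim: "uniform_limit ?B qX q0 ?F" unfolding qX_def q0_def
    by (rule Weierstrass_m_test_general[OF qM M])
  have sub: "\<forall>\<^sub>F X in ?F. finite X \<and> X \<subseteq> A" by (rule eventually_finite_subsets_at_top_weakI) simp
  have qXhol: "qX X holomorphic_on ?B" if "X \<subseteq> A" for X
    unfolding qX_def using that q by (intro holomorphic_on_sum) blast
  have evq: "\<forall>\<^sub>F X in ?F. qX X holomorphic_on ?B"
    using sub by eventually_elim (simp add: qXhol)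
  have q0: "q0 holomorphic_on ?B"
    by (rule holomorphic_on_uniform_limit_open[OF open_ball evq qlim]) simp
  have elim: "uniform_limit ?B (\<lambda>X. eichler_integral z0 n (qX X)) (eichler_integral z0 n q0) ?F"
    by (rule uniform_limit_eichler_integral[OF evq q0 qlim r])
  have "uniform_limit ?B (\<lambda>X z. \<kappa> * eichler_integral z0 n (qX X) z) (\<lambda>z. \<kappa> * eichler_integral z0 n q0 z) ?F"
    using elim by (rule bounded_linear_uniform_limit_intros)
  then have Hlim: "uniform_limit ?B (\<lambda>X z. fX X z - \<kappa> * eichler_integral z0 n (qX X) z) H ?F"
    unfolding H_def by (rule uniform_limit_minus[OF flim])
  have "(\<lambda>z. fX X z - \<kappa> * eichler_integral z0 n (qX X) z) holomorphic_on ?B" if X: "finite X" "X \<subseteq> A" for X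
  proof (subst holomorphic_on_open[OF open_ball], rule ballI)
    fix z assume z: "z \<in> ?B"
    have "\<forall>x\<in>X. \<exists>a. (f x has_derivative (\<lambda>d. a * d + \<kappa> * (z - cnj z) ^ n * cnj (q x z) * cnj d)) (at z)"
      using f z X by blast
    then obtain a where a: "\<And>x. x \<in> X \<Longrightarrow>
        (f x has_derivative (\<lambda>d. a x * d + \<kappa> * (z - cnj z) ^ n * cnj (q x z) * cnj d)) (at z)"
      unfolding bchoice_iff by blast
    obtain b where b: "(eichler_integral z0 n (qX X) has_derivative
        (\<lambda>d. b * d + (z - cnj z) ^ n * cnj (qX X z) * cnj d)) (at z)"
      using eichler_integral_has_derivative[OF qXhol[OF X(2)] z] by blast
    have "(fX X has_derivative (\<lambda>d. \<Sum>x\<in>X. a x * d + \<kappa> * (z - cnj z) ^ n * cnj (q x z) * cnj d)) (at z)"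
      unfolding fX_def by (rule has_derivative_sum) (rule a)
    from has_derivative_diff[OF this has_derivative_mult_right[OF b, of \<kappa>]]
    have "((\<lambda>z. fX X z - \<kappa> * eichler_integral z0 n (qX X) z) has_derivative (\<lambda>d. (sum a X - \<kappa> * b) * d)) (at z)"
      by (simp add: qX_def sum.distrib sum_distrib_left sum_distrib_right algebra_simps)
    then show "\<exists>f'. ((\<lambda>z. fX X z - \<kappa> * eichler_integral z0 n (qX X) z) has_field_derivative f') (at z)"
      unfolding has_field_derivative_def by blast
  qed
  then have "\<forall>\<^sub>F X in ?F. (\<lambda>z. fX X z - \<kappa> * eichler_integral z0 n (qX X) z) holomorphic_on ?B"
    using sub by (auto elim: eventually_mono)
  then have H: "H holomorphic_on ?B"
    using Hlim by (rule holomorphic_on_uniform_limit_open[OF open_ball]) simp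
  have "F z = C * H z + (C * \<kappa>) * eichler_integral z0 n q0 z" if "z \<in> ?B" for z
    using F[OF that] unfolding H_def f0_def by (simp add: algebra_simps)
  note * = holomorphic_plus_eichler_integral[OF this holomorphic_on_mult[OF holomorphic_on_const H] q0 n]
  show "real_analytic_on F ?B" by (rule *(1))
  show "z \<in> ?B \<Longrightarrow> hyperbolic_laplacian (- int n) F z = 0" by (rule *(2))
qed

subsection \<open>The summands off and on the geodesics\<close>

text \<open>With \<open>s\<close> and \<open>c\<close> as sine and cosine the real powers become
  \<open>s ^ (2k-3) / c\<close>. In the application \<open>c = |h| / |Q|\<close>, so the singularity
  of the derivative sits on the geodesic.\<close>

lemma psi_deriv_sq:
  assumes "k \<ge> 2" "0 < s" "0 < c" "s^2 + c^2 = 1"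
  shows "(psi k has_real_derivative 1/2 * (s ^ (2 * k - 3) / c)) (at (s^2))"
proof -
  have "0 < c^2" using assms by simp
  then have "s^2 < 1" using assms(4) by linarith
  then have "(psi k has_real_derivative 1/2 * ((s^2) powr (real k - 3/2) * (1 - s^2) powr (-1/2))) (at (s^2))"
    using assms by (intro psi_deriv) auto
  moreover have "(s^2) powr (real k - 3/2) = s ^ (2 * k - 3)"
  proof -
    have "(s^2) powr (real k - 3/2) = s powr (2 * (real k - 3/2))"
      using assms by (simp add: powr_powr flip: powr_numeral)
    also have "2 * (real k - 3/2) = real (2 * k - 3)" using assms by (simp add: of_nat_diff)
    finally show ?thesis using assms by (simp only: powr_realpow)
  qed
  moreover have "(1 - s^2) powr (-1/2) = 1 / c"
  proof -
    have "1 - s^2 = c powr 2" using assms by simp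
    then have "(1 - s^2) powr (-1/2) = c powr (-1)" by (simp only: powr_powr) simp
    then show ?thesis using assms by (simp add: powr_minus_divide)
  qed
  ultimately show ?thesis by (simp add: mult_ac)
qed

lemma form_height_has_derivative:
  "(form_height (a, b, c) has_derivative
     (\<lambda>d. (2 * of_int a * Re z + of_int b) * Re d + 2 * of_int a * Im z * Im d)) (at z)"
proof -
  have "form_height (a, b, c) = (\<lambda>z. of_int a * ((Re z)^2 + (Im z)^2) + of_int b * Re z + of_int c)"
    by (auto simp: cmod_power2)
  moreover have "((\<lambda>z. of_int a * ((Re z)^2 + (Im z)^2) + of_int b * Re z + of_int c) has_derivative
     (\<lambda>d. (2 * of_int a * Re z + of_int b) * Re d + 2 * of_int a * Im z * Im d)) (at z)"
    by (auto intro!: derivative_eq_intros simp: algebra_simps)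
  ultimately show ?thesis by simp
qed

lemma continuous_on_form_height: "continuous_on S (form_height Q)"
proof (rule has_derivative_continuous_on)
  obtain a b c where Q: "Q = (a, b, c)" by (metis prod_cases3)
  show "(form_height Q has_derivative
      (\<lambda>d. (2 * of_int (fst Q) * Re z + of_int (fst (snd Q))) * Re d + 2 * of_int (fst Q) * Im z * Im d)) (at z within S)" for z
    unfolding Q fst_conv snd_conv by (rule has_derivative_at_withinI[OF form_height_has_derivative])
qed

lemma form_eval_holomorphic: "(\<lambda>z. form_eval Q z 1) holomorphic_on S"
  by (cases Q) (auto intro!: holomorphic_intros)

lemma leading_coeff_nonzero:
  assumes "(a, b, c) \<in> forms_of_disc D" "\<not> (\<exists>m::int. D = m ^ 2)"
  shows "a \<noteq> 0"
  using assms by (auto simp: forms_of_disc_def)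

context nonsquare_disc begin

text \<open>The derivative of the argument of \<open>psi\<close> contains the factor
  \<open>h\<close>, that of \<open>psi\<close> the factor \<open>|Q| / |h|\<close>. Together with
  the sign they leave \<open>|Q|\<close>, so the resulting formula is the same on both sides of the
  geodesic.\<close>

lemma signed_psi_has_derivative:
  assumes Q: "Q \<in> forms_of_disc D" and z: "Im z > 0" and h: "form_height Q z \<noteq> 0" and k: "k \<ge> 2"
  shows "((\<lambda>z. sgn (form_height Q z) * psi k (of_int D * (Im z)^2 / (cmod (form_eval Q z 1))^2)) has_derivative
    (\<lambda>d. sqrt (of_int D) ^ (2 * k - 1) * Im z ^ (2 * k - 2) / cmod (form_eval Q z 1) ^ (2 * k)
       * Im (cnj (form_eval Q z 1) * d))) (at z)"
proof -
  obtain a b c where fields: "Q = (a, b, c)" by (metis prod_cases3)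
  define H where "H = form_height Q z"
  define q where "q = cmod (form_eval Q z 1)"
  define y where "y = Im z"
  define dh where "dh = (\<lambda>d. (2 * of_int a * Re z + of_int b) * Re d + 2 * of_int a * Im z * Im d)"
  define r where "r = sqrt (of_int D)"
  \<comment> \<open>Writing \<open>|Q|^2\<close> as \<open>h^2 + D y^2\<close> lets the argument of
    \<open>psi\<close> be differentiated through the real function \<open>form_height\<close>
    alone.\<close>
  define v where "v = (\<lambda>w. of_int D * (Im w)^2 / ((form_height Q w)^2 + of_int D * (Im w)^2))"
  have D: "real_of_int D = r^2" "r > 0" using D_pos by (auto simp: r_def)
  have y: "y > 0" using z by (simp add: y_def)
  have q: "q > 0" using form_eval_nonzero[OF Q z] by (simp add: q_def)
  have q2: "q^2 = H^2 + r^2 * y^2" using norm_form_eval_sq[OF Q, of z] by (simp add: q_def H_def y_def D)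
  have nz: "H^2 + r^2 * y^2 \<noteq> 0" using q unfolding q2[symmetric] by simp
  have H0: "H \<noteq> 0" using h by (simp add: H_def)
  have dH: "(form_height Q has_derivative dh) (at z)"
    unfolding fields dh_def by (rule form_height_has_derivative)
  have Im: "((\<lambda>w. of_int D * (Im w)^2) has_derivative (\<lambda>d. 2 * r^2 * y * Im d)) (at z)"
    unfolding D by (auto intro!: derivative_eq_intros simp: y_def)
  have "((\<lambda>w. (form_height Q w)^2) has_derivative (\<lambda>d. 2 * H * dh d)) (at z)"
    using has_derivative_power[OF dH, of 2] by (simp add: H_def mult_ac)
  from has_derivative_divide'[OF Im has_derivative_add[OF this Im]]
  have "(v has_derivative (\<lambda>d. (2 * r^2 * y * Im d * (H^2 + r^2 * y^2) - r^2 * y^2 * (2 * H * dh d + 2 * r^2 * y * Im d))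
      / ((H^2 + r^2 * y^2) * (H^2 + r^2 * y^2)))) (at z)"
    using nz unfolding v_def H_def[symmetric] y_def[symmetric] D by simp
  moreover have "2 * r^2 * y * Im d * (H^2 + r^2 * y^2) - r^2 * y^2 * (2 * H * dh d + 2 * r^2 * y * Im d) = 2 * r^2 * y * H * (H * Im d - y * dh d)" for d
    by (simp add: power2_eq_square algebra_simps)
  ultimately have dv: "(v has_derivative (\<lambda>d. 2 * r^2 * y * H * (H * Im d - y * dh d) / (q^2 * q^2))) (at z)"
    unfolding q2 by simp
  define s where "s = r * y / q"
  define co where "co = \<bar>H\<bar> / q"
  have s: "s > 0" "co > 0" using q y D H0 by (auto simp: s_def co_def)
  have sc: "s^2 + co^2 = 1"
  proof -
    have "s^2 + co^2 = (r^2 * y^2 + H^2) / q^2" by (simp add: s_def co_def power_divide power_mult_distrib add_divide_distrib)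
    then show ?thesis using nz q2 by (simp add: add.commute)
  qed
  have vz: "v z = s^2" unfolding v_def s_def H_def[symmetric] y_def[symmetric] D q2[symmetric]
    by (simp add: power_divide power_mult_distrib)
  have dpsi: "(psi k has_real_derivative 1/2 * (s ^ (2 * k - 3) / co)) (at (v z))"
    unfolding vz using psi_deriv_sq[OF k s sc] .
  have d: "((\<lambda>w. sgn H * psi k (v w)) has_derivative
     (\<lambda>d. sgn H * (2 * r^2 * y * H * (H * Im d - y * dh d) / (q^2 * q^2) * (1/2 * (s ^ (2 * k - 3) / co))))) (at z)"
    by (intro has_derivative_mult_right DERIV_compose_FDERIV[OF dpsi dv])
  have coef: "sgn H * (2 * r^2 * y * H * X / (q^2 * q^2) * (1/2 * (s ^ (2 * k - 3) / co)))
      = r ^ (2 * k - 1) * y ^ (2 * k - 2) / q ^ (2 * k) * X" for X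
  proof -
    obtain m where m: "k = m + 2" using k by (metis add.commute le_Suc_ex)
    have e: "2 * k - 3 = 2 * m + 1" "2 * k - 1 = 2 * m + 3" "2 * k - 2 = 2 * m + 2" "2 * k = 2 * m + 4"
      using m by auto
    have "sgn H * H = \<bar>H\<bar>" by (simp add: abs_sgn mult.commute)
    then have sH: "sgn H * H / co = q" using H0 q by (simp add: co_def)
    have "sgn H * (2 * r^2 * y * H * X / (q^2 * q^2) * (1/2 * (S / co)))
        = (sgn H * H / co) * (r^2 * y * X / (q^2 * q^2) * S)" for S
      by (simp add: mult_ac)
    then have "sgn H * (2 * r^2 * y * H * X / (q^2 * q^2) * (1/2 * (s ^ (2 * k - 3) / co)))
        = q * (r^2 * y * X / (q^2 * q^2) * s ^ (2 * k - 3))"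
      unfolding sH .
    also have "\<dots> = r ^ (2 * k - 1) * y ^ (2 * k - 2) / q ^ (2 * k) * X"
      unfolding e s_def using q
      by (simp add: field_simps power_add power2_eq_square power3_eq_cube power4_eq_xxxx)
    finally show ?thesis .
  qed
  \<comment> \<open>This holds because \<open>y * h_x\<close> is the imaginary part of
    \<open>Q\<close> and \<open>h - y * h_y\<close> its real part.\<close>
  have X: "H * Im d - y * dh d = Im (cnj (form_eval Q z 1) * d)" for d
  proof -
    have "Im (cnj w * d) = Re w * Im d - Im w * Re d" for w by simp
    then show ?thesis
      unfolding fields form_eval_complex dh_def H_def y_def form_height.simps cmod_power2
      by (simp add: power2_eq_square algebra_simps)
  qed
  have d': "((\<lambda>w. sgn H * psi k (v w)) has_derivative
     (\<lambda>d. r ^ (2 * k - 1) * y ^ (2 * k - 2) / q ^ (2 * k) * Im (cnj (form_eval Q z 1) * d))) (at z)"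
    using d unfolding coef X .
  \<comment> \<open>On this neighbourhood of \<open>z\<close> the sign of the height is constantly
    \<open>sgn H\<close>.\<close>
  have op: "open {w. H * form_height Q w > 0}"
    by (intro open_Collect_less continuous_intros continuous_on_form_height)
  show ?thesis
    unfolding r_def[symmetric] y_def[symmetric] q_def[symmetric]
  proof (rule has_derivative_transform_within_open[OF d' op])
    show "z \<in> {w. 0 < H * form_height Q w}"
      using H0 by (auto simp: H_def[symmetric] simp flip: power2_eq_square)
    show "sgn H * psi k (v w) = sgn (form_height Q w) * psi k (of_int D * (Im w)^2 / (cmod (form_eval Q w 1))^2)"
      if "w \<in> {w. 0 < H * form_height Q w}" for w
    proof -
      have "sgn H = sgn (form_height Q w)" using that by (auto simp: zero_less_mult_iff)
      then show ?thesis unfolding v_def norm_form_eval_sq[OF Q] by simp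
    qed
  qed
qed

text \<open>Normalised so that \<open>dbar_const k * (z - cnj z) ^ (2k-2)\<close> is
  \<open>(\<i>/2) D^(k-1/2) y^(2k-2)\<close>.\<close>

definition dbar_const :: "nat \<Rightarrow> complex" where
  "dbar_const k = \<i> / 2 * of_real (sqrt (of_int D) ^ (2 * k - 1)) / (2 * \<i>) ^ (2 * k - 2)"

text \<open>Splitting \<open>Im (cnj Q * d)\<close> as
  \<open>(cnj Q * d - Q * cnj d) / (2 \<i>)\<close> gives the \<open>cnj d\<close> coefficient
  \<open>(\<i>/2) K Q^k\<close>; since \<open>|Q|^(2k) = Q^k * cnj (Q^k)\<close>, this is a multiple
  of \<open>cnj (1 / Q^k)\<close>.\<close>

lemma F_summand_has_derivative:
  assumes Q: "Q \<in> forms_of_disc D" and z: "Im z > 0" and h: "form_height Q z \<noteq> 0" and k: "k \<ge> 2"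
  shows "\<exists>a. ((\<lambda>z. F_summand k D z Q) has_derivative
    (\<lambda>d. a * d + dbar_const k * (z - cnj z) ^ (2 * k - 2) * cnj (1 / form_eval Q z 1 ^ k) * cnj d)) (at z)"
proof -
  let ?q = "\<lambda>z. form_eval Q z 1 :: complex"
  define G where "G = (\<lambda>z. sgn (form_height Q z) * psi k (of_int D * (Im z)^2 / (cmod (?q z))^2))"
  define K where "K = sqrt (of_int D) ^ (2 * k - 1) * Im z ^ (2 * k - 2) / cmod (?q z) ^ (2 * k)"
  define p where "p = deriv (\<lambda>z. ?q z ^ (k - 1)) z"
  have q: "?q z \<noteq> 0" using form_eval_nonzero[OF Q z] .
  have "(\<lambda>z. ?q z ^ (k - 1)) holomorphic_on UNIV" by (intro holomorphic_on_power form_eval_holomorphic)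
  then have dq: "((\<lambda>z. ?q z ^ (k - 1)) has_derivative (\<lambda>d. p * d)) (at z)"
    unfolding p_def by (intro has_field_derivative_imp_has_derivative holomorphic_derivI[of _ UNIV]) auto
  have "(G has_derivative (\<lambda>d. K * Im (cnj (?q z) * d))) (at z)"
    unfolding G_def K_def by (rule signed_psi_has_derivative[OF Q z h k])
  then have "((\<lambda>w. ?q w ^ (k - 1) * of_real (G w)) has_derivative
      (\<lambda>d. ?q z ^ (k - 1) * of_real (K * Im (cnj (?q z) * d)) + p * d * of_real (G z))) (at z)"
    by (intro has_derivative_mult dq has_derivative_of_real)
  moreover have "?q z ^ (k - 1) * of_real (K * Im (cnj (?q z) * d)) + p * d * of_real (G z)
     = (p * of_real (G z) + ?q z ^ (k - 1) * of_real K * cnj (?q z) / (2 * \<i>)) * d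
       + dbar_const k * (z - cnj z) ^ (2 * k - 2) * cnj (1 / ?q z ^ k) * cnj d" for d
  proof -
    have "cnj (?q z) * d - ?q z * cnj d = 2 * \<i> * complex_of_real (Im (cnj (?q z) * d))"
      by (simp add: complex_eq_iff algebra_simps)
    then have im: "complex_of_real (Im (cnj (?q z) * d)) = (cnj (?q z) * d - ?q z * cnj d) / (2 * \<i>)"
      by simp
    have kk: "?q z ^ (k - 1) * ?q z = ?q z ^ k" using k by (intro power_minus_mult) simp
    have "z - cnj z = 2 * \<i> * of_real (Im z)" by (simp add: complex_eq_iff)
    then have "dbar_const k * (z - cnj z) ^ (2 * k - 2)
        = \<i> / 2 * of_real (sqrt (of_int D) ^ (2 * k - 1) * Im z ^ (2 * k - 2))"
      unfolding dbar_const_def by (simp add: power_mult_distrib)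
    moreover have "complex_of_real (cmod (?q z) ^ (2 * k)) = ?q z ^ k * cnj (?q z ^ k)"
    proof -
      have "complex_of_real (cmod (?q z) ^ (2 * k)) = complex_of_real ((cmod (?q z))^2) ^ k" by (simp add: power_mult)
      then show ?thesis unfolding complex_norm_square by (simp add: power_mult_distrib)
    qed
    ultimately have dbar: "dbar_const k * (z - cnj z) ^ (2 * k - 2) * cnj (1 / ?q z ^ k) = \<i> / 2 * of_real K * ?q z ^ k"
      unfolding K_def using q by (simp add: field_simps)
    show ?thesis unfolding dbar unfolding im of_real_mult kk[symmetric] by (simp add: field_simps)
  qed
  ultimately have "((\<lambda>w. ?q w ^ (k - 1) * of_real (G w)) has_derivative
    (\<lambda>d. (p * of_real (G z) + ?q z ^ (k - 1) * of_real K * cnj (?q z) / (2 * \<i>)) * d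
       + dbar_const k * (z - cnj z) ^ (2 * k - 2) * cnj (1 / ?q z ^ k) * cnj d)) (at z)"
    by simp
  moreover have "(\<lambda>w. ?q w ^ (k - 1) * of_real (G w)) = (\<lambda>z. F_summand k D z Q)"
    by (auto simp: G_def F_summand_def)
  ultimately show ?thesis by auto
qed

section \<open>Local finiteness of the geodesics\<close>

lemma finite_form_weight_ge:
  assumes "\<epsilon> > 0"
  shows "finite {Q \<in> forms_of_disc D. \<epsilon> \<le> form_weight Q}"
proof (rule finite_subset)
  define N where "N = \<lceil>1 / \<epsilon>\<rceil>"
  show "{Q \<in> forms_of_disc D. \<epsilon> \<le> form_weight Q}
      \<subseteq> (\<lambda>(b, a, c). (a, b, c)) ` (Sigma {- N..N} (\<lambda>b. {(a, c). 4 * a * c = b^2 - D}))"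
  proof
    fix Q assume "Q \<in> {Q \<in> forms_of_disc D. \<epsilon> \<le> form_weight Q}"
    then obtain a b c where Q: "Q = (a, b, c)" "b^2 - 4 * a * c = D" "\<epsilon> \<le> 1 / (1 + (real_of_int b)^2)"
      by (auto simp: forms_of_disc_def form_weight_def)
    have "0 < 1 + (real_of_int b)^2" by (simp add: add_pos_nonneg)
    then have "1 + (real_of_int b)^2 \<le> 1 / \<epsilon>" using Q(3) assms by (simp add: field_simps)
    then have "real_of_int (b^2) \<le> 1 / \<epsilon>" by simp
    also have "\<dots> \<le> real_of_int N" unfolding N_def by (rule le_of_int_ceiling)
    finally have "b^2 \<le> N" by (simp only: of_int_le_iff)
    moreover have "\<bar>b\<bar> \<le> b^2"
    proof (cases "b = 0")
      case False
      then have "\<bar>b\<bar> * 1 \<le> \<bar>b\<bar> * \<bar>b\<bar>" by (intro mult_left_mono) auto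
      then show ?thesis by (simp add: power2_eq_square)
    qed simp
    ultimately have "\<bar>b\<bar> \<le> N" by linarith
    then have "b \<in> {- N..N}" by auto
    then show "Q \<in> (\<lambda>(b, a, c). (a, b, c)) ` (Sigma {- N..N} (\<lambda>b. {(a, c). 4 * a * c = b^2 - D}))"
      using Q by (intro image_eqI[of _ _ "(b, a, c)"]) auto
  qed
  have "b^2 - D \<noteq> 0" for b using D_nonsquare by auto
  then show "finite ((\<lambda>(b, a, c). (a, b, c)) ` (Sigma {- N..N} (\<lambda>b. {(a, c). 4 * a * c = b^2 - D})))"
    by (intro finite_imageI finite_SigmaI card_factorizations_le) auto
qed

lemma ball_in_strip:
  assumes "z \<in> ball \<tau> r" "r \<le> Im \<tau> / 2"
  shows "\<bar>Re z\<bar> \<le> \<bar>Re \<tau>\<bar> + r" "Im \<tau> / 2 \<le> Im z" "Im z \<le> Im \<tau> + r"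
proof -
  have "\<bar>Re (z - \<tau>)\<bar> < r" "\<bar>Im (z - \<tau>)\<bar> < r"
    using assms(1) abs_Re_le_cmod[of "z - \<tau>"] abs_Im_le_cmod[of "z - \<tau>"]
    by (auto simp: dist_norm norm_minus_commute)
  then show "\<bar>Re z\<bar> \<le> \<bar>Re \<tau>\<bar> + r" "Im \<tau> / 2 \<le> Im z" "Im z \<le> Im \<tau> + r"
    using assms(2) by (auto simp: abs_less_iff) 
qed

text \<open>Where \<open>h = 0\<close>, \<open>|Q|^2 = D y^2\<close> is at most
  \<open>D (Im \<tau> + r)^2\<close>, so the strip estimate bounds the weight of \<open>Q\<close>
  below by \<open>1 / M\<close>. Only finitely many forms have such a weight.\<close>

lemma finite_geodesics_meeting_ball:
  assumes "0 < r" "r \<le> Im \<tau> / 2"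
  shows "finite {Q \<in> forms_of_disc D. \<exists>z\<in>ball \<tau> r. form_height Q z = 0}"
proof (rule finite_subset)
  define M where "M = strip_const (\<bar>Re \<tau>\<bar> + r) (Im \<tau> / 2) * (of_int D * (Im \<tau> + r)^2)"
  have M: "0 < M" unfolding M_def using D_pos assms strip_const_ge_1[of "\<bar>Re \<tau>\<bar> + r" "Im \<tau> / 2"]
    by (intro mult_pos_pos) auto
  show "{Q \<in> forms_of_disc D. \<exists>z\<in>ball \<tau> r. form_height Q z = 0} \<subseteq> {Q \<in> forms_of_disc D. 1 / M \<le> form_weight Q}"
  proof clarify
    fix a b c z assume Q: "(a, b, c) \<in> forms_of_disc D" and z: "z \<in> ball \<tau> r" and h: "form_height (a, b, c) z = 0"
    let ?Q = "(a, b, c)"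
    note s = ball_in_strip[OF z assms(2)]
    have y: "0 < Im z" using s assms by linarith
    have "1 \<le> strip_const (\<bar>Re \<tau>\<bar> + r) (Im \<tau> / 2) * (cmod (form_eval ?Q z 1))^2 * form_weight ?Q"
      using s assms by (intro inverse_form_weight_le[OF Q]) auto
    also have "\<dots> \<le> M * form_weight ?Q"
      unfolding M_def norm_form_eval_sq[OF Q] h using strip_const_ge_1[of "\<bar>Re \<tau>\<bar> + r" "Im \<tau> / 2"]
        form_weight_pos[of ?Q] s y D_pos
      by (intro mult_right_mono mult_left_mono) (auto intro: power_mono)
    finally show "1 / M \<le> form_weight ?Q" using M by (simp add: field_simps)
  qed
  show "finite {Q \<in> forms_of_disc D. 1 / M \<le> form_weight Q}" using M by (intro finite_form_weight_ge) simp
qed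

text \<open>Only finitely many geodesics meet a first ball around \<open>\<tau>\<close>; avoiding
  these is an open condition, so a smaller ball avoids all of them.\<close>

lemma ball_avoiding_geodesics:
  assumes \<tau>: "\<tau> \<in> upper_half_plane - exceptional_set D"
  obtains r where "0 < r" "r \<le> Im \<tau> / 2" "\<And>Q z. Q \<in> forms_of_disc D \<Longrightarrow> z \<in> ball \<tau> r \<Longrightarrow> form_height Q z \<noteq> 0"
proof -
  define r0 where "r0 = Im \<tau> / 2"
  have r0: "0 < r0" "r0 \<le> Im \<tau> / 2" using \<tau> by (auto simp: r0_def upper_half_plane_def)
  define S where "S = {Q \<in> forms_of_disc D. \<exists>z\<in>ball \<tau> r0. form_height Q z = 0}"
  have S: "finite S" unfolding S_def by (rule finite_geodesics_meeting_ball[OF r0])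
  define U where "U = ball \<tau> r0 \<inter> (\<Inter>Q\<in>S. {z. form_height Q z \<noteq> 0})"
  have "open U" unfolding U_def
    by (intro open_Int open_ball open_INT S ballI open_Collect_neq continuous_on_form_height continuous_on_const)
  moreover have "\<tau> \<in> U" using \<tau> r0 unfolding U_def S_def exceptional_set_def by auto
  ultimately obtain r1 where r1: "r1 > 0" "ball \<tau> r1 \<subseteq> U" using open_contains_ball_eq by blast
  show thesis
  proof (rule that[of "min r0 r1"])
    fix Q z assume Q: "Q \<in> forms_of_disc D" and z: "z \<in> ball \<tau> (min r0 r1)"
    show "form_height Q z \<noteq> 0"
    proof
      assume "form_height Q z = 0"
      then have "Q \<in> S" using Q z unfolding S_def by auto
      moreover have "z \<in> U" using r1(2) z by auto
      ultimately show False using \<open>form_height Q z = 0\<close> unfolding U_def by blast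
    qed
  qed (use r0 r1 in auto)
qed

section \<open>Real analyticity and harmonicity off the geodesics\<close>

text \<open>The added 1 makes one majorant serve both the summands and \<open>1 / Q^k\<close>, as
  \<open>real_analytic_harmonic_infsum\<close> asks.\<close>

definition local_majorant :: "nat \<Rightarrow> complex \<Rightarrow> real \<Rightarrow> form \<Rightarrow> real" where
  "local_majorant k \<tau> r Q =
     (4 * sqrt (of_int D) ^ (2 * k - 1) * (Im \<tau> + r) ^ (2 * k - 1) + 1)
       * sqrt (strip_const (\<bar>Re \<tau>\<bar> + r) (Im \<tau> / 2)) ^ k * form_weight Q"

lemma local_majorant_summable: "A \<subseteq> forms_of_disc D \<Longrightarrow> local_majorant k \<tau> r summable_on A"
  unfolding local_majorant_def by (intro summable_on_cmult_right form_weight_summable)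

lemma local_majorant_bounds:
  assumes "Q \<in> forms_of_disc D" "0 < r" "r \<le> Im \<tau> / 2" "z \<in> ball \<tau> r" "k \<ge> 2"
  shows "norm (F_summand k D z Q) \<le> local_majorant k \<tau> r Q"
    and "norm (1 / form_eval Q z 1 ^ k) \<le> local_majorant k \<tau> r Q"
proof -
  define W where "W = sqrt (strip_const (\<bar>Re \<tau>\<bar> + r) (Im \<tau> / 2)) ^ k * form_weight Q"
  define T where "T = 4 * sqrt (of_int D) ^ (2 * k - 1)"
  note s = ball_in_strip[OF assms(4,3)]
  have y: "Im \<tau> / 2 > 0" "0 \<le> Im z" using assms s by auto
  have W: "W \<ge> 0" unfolding W_def using strip_const_ge_1[of "\<bar>Re \<tau>\<bar> + r" "Im \<tau> / 2"] form_weight_pos[of Q]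
    by (intro mult_nonneg_nonneg zero_le_power) auto
  have T: "T \<ge> 0" unfolding T_def using D_pos by simp
  have M: "local_majorant k \<tau> r Q = T * (Im \<tau> + r) ^ (2 * k - 1) * W + W"
    unfolding local_majorant_def T_def W_def by (simp add: algebra_simps)
  have "norm (F_summand k D z Q) \<le> T * Im z ^ (2 * k - 1) * W"
    using norm_F_summand_le_weight[OF assms(1) s(1,2) y(1) assms(5)] unfolding T_def W_def by (simp add: mult_ac)
  also have "\<dots> \<le> T * (Im \<tau> + r) ^ (2 * k - 1) * W"
    using T W s y by (intro mult_right_mono mult_left_mono power_mono) auto
  finally show "norm (F_summand k D z Q) \<le> local_majorant k \<tau> r Q" unfolding M using W by simp
  have "norm (1 / form_eval Q z 1 ^ k) \<le> W"
    using inverse_norm_form_eval_power_le[OF assms(1) s(1,2) y(1) assms(5)] unfolding W_def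
    by (simp add: norm_divide norm_power)
  also have "\<dots> \<le> T * (Im \<tau> + r) ^ (2 * k - 1) * W + W" using T W assms y by auto
  finally show "norm (1 / form_eval Q z 1 ^ k) \<le> local_majorant k \<tau> r Q" unfolding M .
qed

lemma F_class_locally_harmonic:
  assumes A: "A \<subseteq> forms_of_disc D" and k: "k \<ge> 2" and \<tau>: "\<tau> \<in> upper_half_plane - exceptional_set D"
  shows "\<exists>U. open U \<and> \<tau> \<in> U \<and> U \<subseteq> upper_half_plane \<and> real_analytic_on (F_class k D A) U \<and>
    (\<forall>z\<in>U. hyperbolic_laplacian (2 - 2 * int k) (F_class k D A) z = 0)"
proof -
  obtain r where r: "0 < r" "r \<le> Im \<tau> / 2"
    and h: "\<And>Q z. Q \<in> forms_of_disc D \<Longrightarrow> z \<in> ball \<tau> r \<Longrightarrow> form_height Q z \<noteq> 0"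
    using ball_avoiding_geodesics[OF \<tau>] by blast
  have up: "Im z > 0" if "z \<in> ball \<tau> r" for z using ball_in_strip(2)[OF that r(2)] r by linarith
  have n: "1 \<le> 2 * k - 2" "2 - 2 * int k = - int (2 * k - 2)" using k by auto
  have 1: "norm (F_summand k D z Q) \<le> local_majorant k \<tau> r Q" "norm (1 / form_eval Q z 1 ^ k) \<le> local_majorant k \<tau> r Q"
    if "Q \<in> A" "z \<in> ball \<tau> r" for Q z
    using that A r k by (intro local_majorant_bounds; blast)+
  have 2: "(\<lambda>z. 1 / form_eval Q z 1 ^ k) holomorphic_on ball \<tau> r" if "Q \<in> A" for Q
  proof -
    have "form_eval Q z 1 \<noteq> (0::complex)" if "z \<in> ball \<tau> r" for z
      using form_eval_nonzero A \<open>Q \<in> A\<close> up[OF that] by blast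
    then show ?thesis by (intro holomorphic_intros form_eval_holomorphic) auto
  qed
  have 3: "\<exists>a. ((\<lambda>z. F_summand k D z Q) has_derivative
      (\<lambda>d. a * d + dbar_const k * (z - cnj z) ^ (2 * k - 2) * cnj (1 / form_eval Q z 1 ^ k) * cnj d)) (at z)"
    if "Q \<in> A" "z \<in> ball \<tau> r" for Q z
  proof -
    have "Q \<in> forms_of_disc D" using that A by blast
    then show ?thesis using that by (intro F_summand_has_derivative up h k)
  qed
  note * = real_analytic_harmonic_infsum[OF r(1) n(1) local_majorant_summable[OF A] 1 2 3 F_class_def]
  have "real_analytic_on (F_class k D A) (ball \<tau> r)" by (rule *(1))
  moreover have "hyperbolic_laplacian (2 - 2 * int k) (F_class k D A) z = 0" if "z \<in> ball \<tau> r" for z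
    unfolding n(2) by (rule *(2)) (use that in simp_all)
  ultimately show ?thesis using r up
    by (intro exI[of _ "ball \<tau> r"]) (auto simp: upper_half_plane_def)
qed

section \<open>Mean values on the geodesics\<close>

text \<open>Without its sign the summand is continuous across the geodesic as well:
  \<open>psi\<close> is continuous up to the argument 1, which is reached exactly where
  \<open>h = 0\<close>. Any jump thus comes from \<open>sgn\<close>.\<close>

lemma F_summand_continuous_factor:
  assumes Q: "Q \<in> forms_of_disc D" and z: "Im z > 0" and k: "k \<ge> 1"
  shows "isCont (\<lambda>z. form_eval Q z 1 ^ (k - 1) * of_real (psi k (of_int D * (Im z)^2 / (cmod (form_eval Q z 1))^2)) :: complex) z"
proof -
  let ?S = "{z. Im z > 0}"
  let ?v = "\<lambda>z. of_int D * (Im z)^2 / (cmod (form_eval Q z 1))^2"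
  have op: "open ?S" by (rule open_halfspace_Im_gt)
  have ce: "continuous_on S (\<lambda>z. form_eval Q z 1 :: complex)" for S
    by (rule holomorphic_on_imp_continuous_on[OF form_eval_holomorphic])
  have "continuous_on ?S (\<lambda>z. psi k (?v z))"
  proof (rule continuous_on_compose2[OF psi_continuous_on[OF k]])
    show "continuous_on ?S ?v"
      using form_eval_nonzero[OF Q] by (intro continuous_intros ce) auto
    show "?v ` ?S \<subseteq> {0..1}"
      using D_pos norm_form_eval_sq[OF Q] by (auto simp: divide_le_eq_1 add_nonneg_pos intro!: divide_nonneg_nonneg)
  qed
  then have "continuous_on ?S (\<lambda>z. form_eval Q z 1 ^ (k - 1) * of_real (psi k (?v z)) :: complex)"
    by (intro continuous_intros ce)
  then show ?thesis using z op by (simp add: continuous_on_eq_continuous_at)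
qed

lemma F_summand_mean_tendsto:
  assumes Q: "Q \<in> forms_of_disc D" and \<tau>: "Im \<tau> > 0" and k: "k \<ge> 2"
  shows "((\<lambda>w::real. 1/2 * (F_summand k D (\<tau> + \<i> * of_real w) Q + F_summand k D (\<tau> - \<i> * of_real w) Q))
    \<longlongrightarrow> F_summand k D \<tau> Q) (at_right 0)"
proof -
  have p: "((\<lambda>w::real. \<tau> + \<i> * of_real w) \<longlongrightarrow> \<tau>) (at_right 0)" "((\<lambda>w::real. \<tau> - \<i> * of_real w) \<longlongrightarrow> \<tau>) (at_right 0)"
    by (auto intro!: tendsto_eq_intros)
  show ?thesis
  proof (cases "form_height Q \<tau> = 0")
    case False
    obtain a where "((\<lambda>z. F_summand k D z Q) has_derivative
      (\<lambda>d. a * d + dbar_const k * (\<tau> - cnj \<tau>) ^ (2 * k - 2) * cnj (1 / form_eval Q \<tau> 1 ^ k) * cnj d)) (at \<tau>)"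
      using F_summand_has_derivative[OF Q \<tau> False k] by blast
    then have c: "isCont (\<lambda>z. F_summand k D z Q) \<tau>" by (rule has_derivative_continuous)
    have "((\<lambda>w::real. 1/2 * (F_summand k D (\<tau> + \<i> * of_real w) Q + F_summand k D (\<tau> - \<i> * of_real w) Q))
        \<longlongrightarrow> 1/2 * (F_summand k D \<tau> Q + F_summand k D \<tau> Q)) (at_right 0)"
      by (intro tendsto_mult tendsto_const tendsto_add isCont_tendsto_compose[OF c] p)
    then show ?thesis by simp
  next
    case True
    obtain a b c where fields: "Q = (a, b, c)" by (metis prod_cases3)
    have a: "a \<noteq> 0" using Q D_nonsquare leading_coeff_nonzero unfolding fields by blast
    define P where "P = (\<lambda>z. form_eval Q z 1 ^ (k - 1) * of_real (psi k (of_int D * (Im z)^2 / (cmod (form_eval Q z 1))^2)) :: complex)"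
    have c: "isCont P \<tau>" unfolding P_def using k by (intro F_summand_continuous_factor[OF Q \<tau>]) simp
    have FP: "F_summand k D z Q = of_real (sgn (form_height Q z)) * P z" for z
      unfolding F_summand_def P_def by (simp add: mult_ac)
    \<comment> \<open>The two one-sided values carry opposite signs, so their mean tends to 0; this
      is the value at \<open>\<tau>\<close> because \<open>sgn 0 = 0\<close>.\<close>
    have "((\<lambda>w::real. 1/2 * of_real (sgn (of_int a)) * (P (\<tau> + \<i> * of_real w) - P (\<tau> - \<i> * of_real w)))
        \<longlongrightarrow> 1/2 * of_real (sgn (of_int a)) * (P \<tau> - P \<tau>)) (at_right 0)"
      by (intro tendsto_mult tendsto_const tendsto_diff isCont_tendsto_compose[OF c] p)
    then have lim: "((\<lambda>w::real. 1/2 * of_real (sgn (of_int a)) * (P (\<tau> + \<i> * of_real w) - P (\<tau> - \<i> * of_real w)))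
        \<longlongrightarrow> F_summand k D \<tau> Q) (at_right 0)"
      by (simp add: FP True)
    have "\<forall>\<^sub>F w in at_right 0. w \<in> {0<..<Im \<tau>}"
      using \<tau> by (rule eventually_at_right_real)
    then show ?thesis
    proof (rule Lim_transform_eventually[OF lim, OF eventually_mono])
      fix w assume w: "w \<in> {0<..<Im \<tau>}"
      \<comment> \<open>Subtracting the vanishing height at \<open>\<tau>\<close> leaves
        \<open>a * ((Im \<tau> + w)^2 - (Im \<tau>)^2)\<close> above and the same with
        \<open>- w\<close> below; for \<open>0 < w < Im \<tau>\<close> the signs are
        opposite.\<close>
      have 1: "form_height Q (\<tau> + \<i> * of_real w) = of_int a * (w * (2 * Im \<tau> + w))"
        using True unfolding fields form_height.simps cmod_power2 by (simp add: power2_eq_square algebra_simps)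
      have 2: "form_height Q (\<tau> - \<i> * of_real w) = of_int a * (w * (w - 2 * Im \<tau>))"
        using True unfolding fields form_height.simps cmod_power2 by (simp add: power2_eq_square algebra_simps)
      have "sgn (w * (2 * Im \<tau> + w)) = 1" "sgn (w * (w - 2 * Im \<tau>)) = -1"
        using w \<tau> by (auto simp: sgn_mult)
      then have "sgn (form_height Q (\<tau> + \<i> * of_real w)) = sgn (of_int a)"
        "sgn (form_height Q (\<tau> - \<i> * of_real w)) = - sgn (of_int a)"
        unfolding 1 2 by (simp_all only: sgn_mult)
      then show "1/2 * of_real (sgn (of_int a)) * (P (\<tau> + \<i> * of_real w) - P (\<tau> - \<i> * of_real w)) =
         1/2 * (F_summand k D (\<tau> + \<i> * of_real w) Q + F_summand k D (\<tau> - \<i> * of_real w) Q)"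
        unfolding FP by (simp add: algebra_simps)
    qed
  qed
qed

text \<open>The two values are averaged inside the sum. The majorant does not depend on
  \<open>w\<close>, so convergence is uniform in \<open>w\<close> and the limit may be taken term by
  term.\<close>

lemma F_class_mean_tendsto:
  assumes A: "A \<subseteq> forms_of_disc D" and k: "k \<ge> 2" and \<tau>: "Im \<tau> > 0"
  shows "((\<lambda>w::real. 1/2 * (F_class k D A (\<tau> + \<i> * of_real w) + F_class k D A (\<tau> - \<i> * of_real w)))
    \<longlongrightarrow> F_class k D A \<tau>) (at_right 0)"
proof -
  define r where "r = Im \<tau> / 2"
  have r: "0 < r" "r \<le> Im \<tau> / 2" using \<tau> by (auto simp: r_def)
  define C where "C = complex_of_real ((-1)^k * real_of_int D powr (1/2 - real k) / (real ((2 * k - 2) choose (k - 1)) * pi))"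
  define g where "g = (\<lambda>Q (w::real). 1/2 * (F_summand k D (\<tau> + \<i> * of_real w) Q + F_summand k D (\<tau> - \<i> * of_real w) Q))"
  have inb: "\<tau> + \<i> * of_real w \<in> ball \<tau> r" "\<tau> - \<i> * of_real w \<in> ball \<tau> r" if "w \<in> {0<..<r}" for w
    using that by (auto simp: dist_norm norm_mult)
  have ulim: "uniform_limit {0<..<r} (\<lambda>X w. \<Sum>Q\<in>X. g Q w) (\<lambda>w. \<Sum>\<^sub>\<infinity>Q\<in>A. g Q w) (finite_subsets_at_top A)"
  proof (rule Weierstrass_m_test_general[OF _ local_majorant_summable[OF A, of k \<tau> r]])
    fix Q w assume Q: "Q \<in> A" and w: "w \<in> {0<..<r}"
    have "norm (F_summand k D (\<tau> + \<i> * of_real w) Q) \<le> local_majorant k \<tau> r Q"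
      "norm (F_summand k D (\<tau> - \<i> * of_real w) Q) \<le> local_majorant k \<tau> r Q"
      using A Q inb[OF w] r k by (auto intro!: local_majorant_bounds(1))
    then have "norm (F_summand k D (\<tau> + \<i> * of_real w) Q + F_summand k D (\<tau> - \<i> * of_real w) Q) \<le> 2 * local_majorant k \<tau> r Q"
      by (intro order.trans[OF norm_triangle_ineq]) simp
    then show "norm (g Q w) \<le> local_majorant k \<tau> r Q" unfolding g_def by (simp add: norm_mult)
  qed
  have "((\<lambda>w. \<Sum>\<^sub>\<infinity>Q\<in>A. g Q w) \<longlongrightarrow> (\<Sum>\<^sub>\<infinity>Q\<in>A. F_summand k D \<tau> Q)) (at_right 0)"
  proof (rule swap_uniform_limit'[OF _ _ ulim])
    have "\<forall>\<^sub>F X in finite_subsets_at_top A. finite X \<and> X \<subseteq> A" by (rule eventually_finite_subsets_at_top_weakI) simp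
    then show "\<forall>\<^sub>F X in finite_subsets_at_top A. ((\<lambda>w. \<Sum>Q\<in>X. g Q w) \<longlongrightarrow> (\<Sum>Q\<in>X. F_summand k D \<tau> Q)) (at_right 0)"
    proof (rule eventually_mono)
      fix X assume "finite X \<and> X \<subseteq> A"
      then show "((\<lambda>w. \<Sum>Q\<in>X. g Q w) \<longlongrightarrow> (\<Sum>Q\<in>X. F_summand k D \<tau> Q)) (at_right 0)"
        unfolding g_def using A by (intro tendsto_sum F_summand_mean_tendsto[OF _ \<tau> k]) auto
    qed
    have "(F_summand k D \<tau> has_sum (\<Sum>\<^sub>\<infinity>Q\<in>A. F_summand k D \<tau> Q)) A"
      using F_summand_summable[OF A \<tau> k] by simp
    then show "((\<lambda>X. \<Sum>Q\<in>X. F_summand k D \<tau> Q) \<longlongrightarrow> (\<Sum>\<^sub>\<infinity>Q\<in>A. F_summand k D \<tau> Q)) (finite_subsets_at_top A)"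
      by (simp add: has_sum_def)
    show "\<forall>\<^sub>F w in at_right 0. w \<in> {0<..<r}" using r(1) by (rule eventually_at_right_real)
  qed simp
  then have lim: "((\<lambda>w. C * (\<Sum>\<^sub>\<infinity>Q\<in>A. g Q w)) \<longlongrightarrow> F_class k D A \<tau>) (at_right 0)"
    unfolding F_class_def C_def by (intro tendsto_mult tendsto_const)
  have "\<forall>\<^sub>F w in at_right 0. w \<in> {0<..<r}" using r(1) by (rule eventually_at_right_real)
  then show ?thesis
  proof (rule Lim_transform_eventually[OF lim, OF eventually_mono])
    fix w assume w: "w \<in> {0<..<r}"
    have "F_summand k D (\<tau> + \<i> * of_real w) summable_on A" "F_summand k D (\<tau> - \<i> * of_real w) summable_on A"
      using w r \<tau> by (intro F_summand_summable[OF A _ k]; simp)+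
    then have "(\<Sum>\<^sub>\<infinity>Q\<in>A. g Q w) = 1/2 * ((\<Sum>\<^sub>\<infinity>Q\<in>A. F_summand k D (\<tau> + \<i> * of_real w) Q)
        + (\<Sum>\<^sub>\<infinity>Q\<in>A. F_summand k D (\<tau> - \<i> * of_real w) Q))"
      unfolding g_def by (simp only: infsum_cmult_right' infsum_add)
    then show "C * (\<Sum>\<^sub>\<infinity>Q\<in>A. g Q w) = 1/2 * (F_class k D A (\<tau> + \<i> * of_real w) + F_class k D A (\<tau> - \<i> * of_real w))"
      unfolding F_class_def C_def[symmetric] by (simp add: algebra_simps)
  qed
qed

end

text \<open>Summability is asserted separately because the infinite sum of a non-summable family is
  0 by convention; it ensures that \<open>F_class\<close> is given by a genuine convergent
  series.\<close>

theorem theorem7p4: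
  fixes k :: nat and D :: int and A :: "form set"
  assumes "k > 1"
    and "D > 0" and "is_discriminant D" and "\<not> (\<exists>m::int. D = m^2)"
    and "narrow_class D A"
  shows "(\<forall>\<tau>\<in>upper_half_plane. F_summand k D \<tau> summable_on A) \<and>
         locally_harmonic_Maass_form (2 - 2 * int k) (exceptional_set D) (F_class k D A)"
proof -
  interpret nonsquare_disc D using assms by unfold_locales
  have k: "k \<ge> 2" "k \<ge> 1" using assms by auto
  have A: "A \<subseteq> forms_of_disc D" using assms narrow_class_subset by blast
  have "F_summand k D \<tau> summable_on A" if "\<tau> \<in> upper_half_plane" for \<tau>
    using that F_summand_summable[OF A _ k(1)] by (simp add: upper_half_plane_def)
  moreover have "slash (2 - 2 * int k) (F_class k D A) g \<tau> = F_class k D A \<tau>"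
    if "g \<in> SL2Z" "\<tau> \<in> upper_half_plane" for g \<tau>
    using that F_class_modular[OF assms(5) _ _ k(2)] by (simp add: upper_half_plane_def)
  moreover have "((\<lambda>w::real. 1/2 * (F_class k D A (\<tau> + \<i> * of_real w) + F_class k D A (\<tau> - \<i> * of_real w)))
      \<longlongrightarrow> F_class k D A \<tau>) (at_right 0)" if "\<tau> \<in> exceptional_set D" for \<tau>
    using that F_class_mean_tendsto[OF A k(1)] by (simp add: exceptional_set_def upper_half_plane_def)
  ultimately show ?thesis
    unfolding locally_harmonic_Maass_form_def
    using F_class_locally_harmonic[OF A k(1)] F_class_growth[OF assms(5) k(1)] by blast
qed

end
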